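(* Suppose $H$ is a strongly quasiconvex codimension 1 subgroup of a finitely generated group $G$. Then the corresponding $\mathrm{CAT}(0)$ cube complex (obtained by Sageev's construction) is finite dimensional.
   Context: A $(K,L)$-quasi-geodesic in a metric space $X$ is a map $c$ from an interval of $\mathbb{R}$ to $X$ with $\frac1K|s-t|-L\le d(c(s),c(t))\le K|s-t|+L$. A subgroup $H$ of a finitely generated group $G$ is strongly quasiconvex in $G$ if, in the Cayley graph of $G$ for some (equivalently any) finite generating set, for every $K\ge1$, $C\ge0$ there is $M=M(K,C)$ such that every $(K,C)$-quasi-geodesic with endpoints on $H$ is contained in the $M$-neighborhood of $H$. $H\le G$ is a codimension 1 subgroup if there is an $H$-almost invariant set $A\subset G$, i.e. $HA=A$, both $H\backslash A$ and $H\backslash (G-A)$ are infinite, and $H\backslash (A\,\triangle\, As)$ is finite for every $s\in G$ (equivalently, the quotient of the Cayley graph of $G$ by $H$ has more than one end). Sageev's construction: fix such an $A$, write $B^c=G-B$, and let $\Sigma=\{gA : g\in G\}\cup\{gA^c : g\in G\}$, partially ordered by inclusion. An ultrafilter is a subset $V\subset\Sigma$ containing exactly one element of each pair $\{B,B^c\}$ with $B\in\Sigma$ and such that $B\in V$, $B\subset B'\in\Sigma$ imply $B'\in V$. Form the graph whose vertices are ultrafilters, with two joined by an edge when they differ on exactly one pair $\{B,B^c\}$. The principal ultrafilters $V_g=\{B\in\Sigma : g\in B\}$, $g\in G$, all lie in a single connected component; the cube complex corresponding to $H$ (and $A$) is obtained from this component by attaching an $n$-cube ($n\ge2$) to each subgraph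 isomorphic to the 1-skeleton of an $n$-cube. It is a $\mathrm{CAT}(0)$ cube complex on which $G$ acts. *)

theory Defs
  imports
    "HOL-Algebra.Generated_Groups"
    "HOL-Analysis.Topology_Euclidean_Space"
begin

section \<open>Simple graphs\<close>

text \<open>A simple graph is a pair of a vertex set and a set of two-element edges.\<close>

type_synonym 'v graph = "'v set \<times> 'v set set"

abbreviation verts :: "'v graph \<Rightarrow> 'v set" where "verts X \<equiv> fst X"
abbreviation edges :: "'v graph \<Rightarrow> 'v set set" where "edges X \<equiv> snd X"

definition adjacency :: "'v graph \<Rightarrow> ('v \<times> 'v) set" where
  "adjacency X = {(u, v). u \<noteq> v \<and> {u, v} \<in> edges X}"

text \<open>Meaningful only for vertices in the same connected component.\<close>

definition graph_dist :: "'v graph \<Rightarrow> 'v \<Rightarrow> 'v \<Rightarrow> nat" where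
  "graph_dist X u v = (LEAST n. (u, v) \<in> adjacency X ^^ n)"

definition subgraph :: "'v graph \<Rightarrow> 'v graph \<Rightarrow> bool" where
  "subgraph Y X \<longleftrightarrow> verts Y \<subseteq> verts X \<and> edges Y \<subseteq> edges X \<and> (\<forall>e\<in>edges Y. e \<subseteq> verts Y)"

definition graph_isomorphic :: "'v graph \<Rightarrow> 'w graph \<Rightarrow> bool" where
  "graph_isomorphic X Y \<longleftrightarrow>
     (\<exists>f. bij_betw f (verts X) (verts Y) \<and> edges Y = (\<lambda>e. f ` e) ` edges X)"

definition graph_component :: "'v graph \<Rightarrow> 'v \<Rightarrow> 'v graph" where
  "graph_component X v =
     (let C = {w \<in> verts X. (v, w) \<in> (adjacency X)\<^sup>*} in (C, {e \<in> edges X. e \<subseteq> C}))"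


section \<open>The geometric realization of a graph\<close>

text \<open>
  Points are given by barycentric coordinates, so that they are supported on a vertex or on an
  edge, and the vertex \<open>v\<close> is the point \<open>indicator {v}\<close>. All edges have length one.
\<close>

definition support :: "('v \<Rightarrow> real) \<Rightarrow> 'v set" where
  "support x = {v. x v \<noteq> 0}"

definition realization :: "'v graph \<Rightarrow> ('v \<Rightarrow> real) set" where
  "realization X =
     {x. (\<forall>v. 0 \<le> x v) \<and> (support x \<in> edges X \<or> (\<exists>v\<in>verts X. support x = {v}))
         \<and> (\<Sum>v\<in>support x. x v) = 1}"

text \<open>
  The path metric of a connected graph. Two points of a common edge with ends \<open>u\<close>, \<open>v\<close> are at
  distance \<open>\<bar>x u - y u\<bar> = \<bar>x v - y v\<bar>\<close>, which is half of the sum below. Otherwise a shortest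
  path from \<open>x\<close> to \<open>y\<close> runs from \<open>x\<close> to an end \<open>u\<close> of its edge, which takes length \<open>1 - x u\<close>, then
  along edges to an end \<open>v\<close> of the edge of \<open>y\<close>, and from there to \<open>y\<close>.
\<close>

definition realization_dist :: "'v graph \<Rightarrow> ('v \<Rightarrow> real) \<Rightarrow> ('v \<Rightarrow> real) \<Rightarrow> real" where
  "realization_dist X x y =
     (if \<exists>e\<in>edges X. support x \<union> support y \<subseteq> e
      then (\<Sum>v\<in>support x \<union> support y. \<bar>x v - y v\<bar>) / 2
      else Min {(1 - x u) + real (graph_dist X u v) + (1 - y v) | u v.
                  u \<in> support x \<and> v \<in> support y})"


section \<open>Strongly quasiconvex subgroups\<close>

text \<open>In this section \<open>(X, d)\<close> is a metric space with underlying set \<open>X\<close>.\<close>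

definition quasi_geodesic ::
  "'p set \<Rightarrow> ('p \<Rightarrow> 'p \<Rightarrow> real) \<Rightarrow> real \<Rightarrow> real \<Rightarrow> real set \<Rightarrow> (real \<Rightarrow> 'p) \<Rightarrow> bool" where
  "quasi_geodesic X d K L I c \<longleftrightarrow>
     is_interval I \<and> c ` I \<subseteq> X \<and>
     (\<forall>s\<in>I. \<forall>t\<in>I. 1 / K * \<bar>s - t\<bar> - L \<le> d (c s) (c t) \<and> d (c s) (c t) \<le> K * \<bar>s - t\<bar> + L)"

definition metric_neighborhood :: "'p set \<Rightarrow> ('p \<Rightarrow> 'p \<Rightarrow> real) \<Rightarrow> real \<Rightarrow> 'p set \<Rightarrow> 'p set" where
  "metric_neighborhood X d M Y = {x \<in> X. \<exists>y\<in>Y. d x y \<le> M}"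

definition strongly_quasiconvex_subset :: "'p set \<Rightarrow> ('p \<Rightarrow> 'p \<Rightarrow> real) \<Rightarrow> 'p set \<Rightarrow> bool" where
  "strongly_quasiconvex_subset X d Y \<longleftrightarrow>
     (\<forall>K\<ge>1. \<forall>C\<ge>0. \<exists>M. \<forall>a b c.
        a \<le> b \<and> quasi_geodesic X d K C {a..b} c \<and> c a \<in> Y \<and> c b \<in> Y
          \<longrightarrow> c ` {a..b} \<subseteq> metric_neighborhood X d M Y)"

definition finite_generating_set :: "('a, 'm) monoid_scheme \<Rightarrow> 'a set \<Rightarrow> bool" where
  "finite_generating_set G S \<longleftrightarrow> finite S \<and> S \<subseteq> carrier G \<and> generate G S = carrier G"

definition finitely_generated_group :: "('a, 'm) monoid_scheme \<Rightarrow> bool" where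
  "finitely_generated_group G \<longleftrightarrow> group G \<and> (\<exists>S. finite_generating_set G S)"

definition cayley_graph :: "('a, 'm) monoid_scheme \<Rightarrow> 'a set \<Rightarrow> 'a graph" where
  "cayley_graph G S =
     (carrier G, {{g, g \<otimes>\<^bsub>G\<^esub> s} | g s. g \<in> carrier G \<and> s \<in> S \<and> s \<noteq> \<one>\<^bsub>G\<^esub>})"

definition strongly_quasiconvex :: "('a, 'm) monoid_scheme \<Rightarrow> 'a set \<Rightarrow> bool" where
  "strongly_quasiconvex G H \<longleftrightarrow>
     subgroup H G \<and>
     (\<exists>S. finite_generating_set G S \<and>
        strongly_quasiconvex_subset
          (realization (cayley_graph G S)) (realization_dist (cayley_graph G S))
          ((\<lambda>h. indicator {h}) ` H))"


section \<open>Codimension one subgroups\<close>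

definition left_quotient :: "('a, 'm) monoid_scheme \<Rightarrow> 'a set \<Rightarrow> 'a set \<Rightarrow> 'a set set" where
  "left_quotient G H B = (\<lambda>x. H #>\<^bsub>G\<^esub> x) ` B"

definition almost_invariant :: "('a, 'm) monoid_scheme \<Rightarrow> 'a set \<Rightarrow> 'a set \<Rightarrow> bool" where
  "almost_invariant G H A \<longleftrightarrow>
     A \<subseteq> carrier G \<and> H <#>\<^bsub>G\<^esub> A = A \<and>
     infinite (left_quotient G H A) \<and> infinite (left_quotient G H (carrier G - A)) \<and>
     (\<forall>s\<in>carrier G. finite (left_quotient G H (sym_diff A (A #>\<^bsub>G\<^esub> s))))"

definition codimension_one :: "('a, 'm) monoid_scheme \<Rightarrow> 'a set \<Rightarrow> bool" where
  "codimension_one G H \<longleftrightarrow> subgroup H G \<and> (\<exists>A. almost_invariant G H A)"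


section \<open>Cube complexes\<close>

definition cube_skeleton :: "nat \<Rightarrow> nat set graph" where
  "cube_skeleton n = (Pow {..<n}, {{P, insert i P} | P i. P \<subseteq> {..<n} \<and> i < n \<and> i \<notin> P})"

text \<open>
  A cube complex is described by its cubes, each recorded as its dimension together with its
  1-skeleton. The complex below is obtained from a graph by attaching an \<open>n\<close>-cube, \<open>n \<ge> 2\<close>, to
  each subgraph isomorphic to the 1-skeleton of an \<open>n\<close>-cube; for \<open>n = 0\<close> and \<open>n = 1\<close> the same
  condition gives the vertices and the edges of the graph itself.
\<close>

type_synonym 'v cube_complex = "(nat \<times> 'v graph) set"

definition attach_cubes :: "'v graph \<Rightarrow> 'v cube_complex" where
  "attach_cubes X = {(n, Q). subgraph Q X \<and> graph_isomorphic (cube_skeleton n) Q}"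

definition finite_dimensional :: "'v cube_complex \<Rightarrow> bool" where
  "finite_dimensional K \<longleftrightarrow> (\<exists>N. \<forall>(n, Q)\<in>K. n \<le> N)"


section \<open>Sageev's construction\<close>

definition sageev_halfspaces :: "('a, 'm) monoid_scheme \<Rightarrow> 'a set \<Rightarrow> 'a set set" where
  "sageev_halfspaces G A =
     {g <#\<^bsub>G\<^esub> A | g. g \<in> carrier G} \<union> {g <#\<^bsub>G\<^esub> (carrier G - A) | g. g \<in> carrier G}"

definition sageev_ultrafilter :: "('a, 'm) monoid_scheme \<Rightarrow> 'a set \<Rightarrow> 'a set set \<Rightarrow> bool" where
  "sageev_ultrafilter G A V \<longleftrightarrow>
     V \<subseteq> sageev_halfspaces G A \<and>
     (\<forall>B\<in>sageev_halfspaces G A. (B \<in> V) \<noteq> (carrier G - B \<in> V)) \<and>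
     (\<forall>B\<in>V. \<forall>B'\<in>sageev_halfspaces G A. B \<subseteq> B' \<longrightarrow> B' \<in> V)"

definition principal_ultrafilter :: "('a, 'm) monoid_scheme \<Rightarrow> 'a set \<Rightarrow> 'a \<Rightarrow> 'a set set" where
  "principal_ultrafilter G A g = {B \<in> sageev_halfspaces G A. g \<in> B}"

definition sageev_graph :: "('a, 'm) monoid_scheme \<Rightarrow> 'a set \<Rightarrow> 'a set set graph" where
  "sageev_graph G A =
     ({V. sageev_ultrafilter G A V},
      {{V, W} | V W. sageev_ultrafilter G A V \<and> sageev_ultrafilter G A W \<and>
         (\<exists>B\<in>sageev_halfspaces G A. sym_diff V W = {B, carrier G - B})})"

text \<open>
  If \<open>G\<close> is finitely generated and \<open>A\<close> is almost invariant, then all principal ultrafilters lie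
  in a single component, so taking the one of the identity is no restriction.
\<close>

definition sageev_complex :: "('a, 'm) monoid_scheme \<Rightarrow> 'a set \<Rightarrow> 'a set set cube_complex" where
  "sageev_complex G A =
     attach_cubes (graph_component (sageev_graph G A) (principal_ultrafilter G A \<one>\<^bsub>G\<^esub>))"

end

theory Submission
  imports Defs
begin

text \<open>
  An \<open>n\<close>-cube of Sageev's complex yields \<open>n\<close> translates of \<open>A\<close> any two of which cross, in the sense
  that all four corners are nonempty (\<open>sageev_cube_crossing\<close>). The coboundary of a translate \<open>gA\<close>
  lies near the coset \<open>gH\<close> (\<open>almost_invariant_coboundary\<close>). Since \<open>H\<close> is quasiconvex, neighbourhoods
  of its cosets are connected, and so the cosets of two crossing translates are uniformly close
  (\<open>crossing_sets_close\<close>). The translate \<open>gA\<close> depends only on \<open>gH\<close>. Thus it suffices to bound the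
  number of distinct cosets of \<open>H\<close> that are pairwise within distance \<open>D\<close>, in other words to show that
  \<open>H\<close> has bounded packing (\<open>bounded_packing\<close>).

  Bounded packing follows from a coarse Helly property (\<open>morse_sets_coarse_helly\<close>): pairwise close,
  uniformly strongly quasiconvex sets all meet a ball whose radius is independent of their number.
  To see this, take a point \<open>z\<close> whose maximal distance \<open>R\<close> to the sets is minimal, and move it to its
  projection on a set at distance \<open>R\<close>. If the projection shrinks the ball of radius \<open>R\<close> about \<open>z\<close> to
  diameter at most \<open>R / 2\<close> plus a constant, the new point is within \<open>R / 2\<close> plus a constant of all the
  sets, and minimality bounds \<open>R\<close>.

  The contraction of projections (\<open>morse_projection_contracts\<close>) is where strong quasiconvexity is
  used in full. Suppose that each step of a walk costs \<open>k\<close> near the set \<open>Y\<close> and \<open>1\<close> elsewhere.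
  Cheapest walks are \<open>(k, 0)\<close>-quasi-geodesics, so those with ends on \<open>Y\<close> stay near \<open>Y\<close> and cost at
  least \<open>k\<close> times the distance of their ends. But two projections of points of the ball are also
  joined by a walk through \<open>z\<close> of length \<open>O(R)\<close> that is mostly far from \<open>Y\<close>, hence costs
  \<open>O(R) + O(k)\<close>, where the second implied constant may depend on \<open>k\<close>. So the distance of the
  projections is at most \<open>O(R / k)\<close> plus a constant.
\<close>


section \<open>Integer-valued geodesic metrics and Morse sets\<close>

text \<open>
  The vertex set of a connected graph with its path metric. The coarse geometry below only needs
  vertices, so that paths can be sequences of points and distances natural numbers; the axiom
  \<open>d_interpolate\<close> replaces the existence of geodesics in the realization.
\<close>

locale geodesic_graph_metric =
  fixes X :: "'p set" and d :: "'p \<Rightarrow> 'p \<Rightarrow> nat"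
  assumes d_eq_0: "\<lbrakk>x \<in> X; y \<in> X\<rbrakk> \<Longrightarrow> d x y = 0 \<longleftrightarrow> x = y"
    and d_sym: "\<lbrakk>x \<in> X; y \<in> X\<rbrakk> \<Longrightarrow> d x y = d y x"
    and d_triangle: "\<lbrakk>x \<in> X; y \<in> X; z \<in> X\<rbrakk> \<Longrightarrow> d x z \<le> d x y + d y z"
    and d_interpolate: "\<lbrakk>x \<in> X; y \<in> X; d x y = m + n\<rbrakk> \<Longrightarrow> \<exists>z\<in>X. d x z = m \<and> d z y = n"
begin

lemma geodesic_exists:
  assumes "u \<in> X" "v \<in> X"
  shows "\<exists>g. g 0 = u \<and> g (d u v) = v \<and> (\<forall>i\<le>d u v. g i \<in> X)
    \<and> (\<forall>i j. i \<le> j \<longrightarrow> j \<le> d u v \<longrightarrow> d (g i) (g j) = j - i)"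
  using assms
proof (induction "d u v" arbitrary: u)
  case 0
  then have "u = v" using d_eq_0 by simp
  then show ?case using 0 by (intro exI[of _ "\<lambda>_. u"]) auto
next
  case (Suc n)
  obtain z where z: "z \<in> X" "d u z = 1" "d z v = n"
    using d_interpolate[of u v 1 n] Suc by auto
  obtain h where h: "h 0 = z" "h n = v" "\<And>i. i \<le> n \<Longrightarrow> h i \<in> X"
      "\<And>i j. i \<le> j \<Longrightarrow> j \<le> n \<Longrightarrow> d (h i) (h j) = j - i"
    using Suc(1)[of z] z Suc(4) by auto
  define g where "g = case_nat u h"
  have start: "d u (h j) = Suc j" if "j \<le> n" for j
  proof -
    have "d u (h j) \<le> 1 + j"
      using d_triangle[of u z "h j"] z h(1) h(4)[of 0 j] h(3)[of j] that Suc(3) by simp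
    moreover have "Suc n \<le> d u (h j) + (n - j)"
      using d_triangle[of u "h j" v] h(2) h(3)[of j] h(4)[of j n] that Suc by simp
    ultimately show ?thesis using that by simp
  qed
  have "d (g i) (g j) = j - i" if "i \<le> j" "j \<le> Suc n" for i j
    using that h(4) start d_eq_0[of u u] Suc(3) unfolding g_def by (auto split: nat.split)
  moreover have "\<forall>i\<le>Suc n. g i \<in> X"
    using h(3) Suc(3) unfolding g_def by (auto split: nat.split)
  ultimately show ?case
    using h(2) unfolding Suc(2)[symmetric] by (intro exI[of _ g]) (auto simp: g_def)
qed

definition dist_to :: "'p set \<Rightarrow> 'p \<Rightarrow> nat" where
  "dist_to Y v = (INF y\<in>Y. d v y)"

lemma dist_to_le: "y \<in> Y \<Longrightarrow> dist_to Y v \<le> d v y"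
  unfolding dist_to_def by (rule cINF_lower) auto

lemma nearest_point_exists:
  assumes "Y \<noteq> {}"
  shows "\<exists>y\<in>Y. d v y = dist_to Y v"
proof -
  have "dist_to Y v \<in> d v ` Y"
    unfolding dist_to_def using assms by (intro Inf_nat_def1) auto
  then show ?thesis by force
qed

lemma dist_to_eq_0: "y \<in> Y \<Longrightarrow> y \<in> X \<Longrightarrow> dist_to Y y = 0"
  using dist_to_le[of y Y y] d_eq_0[of y y] by simp

lemma dist_to_lipschitz:
  assumes "Y \<subseteq> X" "Y \<noteq> {}" "u \<in> X" "v \<in> X"
  shows "dist_to Y u \<le> d u v + dist_to Y v"
proof -
  obtain y where "y \<in> Y" "d v y = dist_to Y v" using nearest_point_exists assms by blast
  then show ?thesis using dist_to_le[of y Y u] d_triangle[of u v y] assms by fastforce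
qed

text \<open>
  Consecutive points of the sequence may be far apart when \<open>L > 0\<close>. This freedom is used to move
  an end of a sequence by a bounded amount.
\<close>

definition discrete_quasi_geodesic :: "nat \<Rightarrow> nat \<Rightarrow> nat \<Rightarrow> (nat \<Rightarrow> 'p) \<Rightarrow> bool" where
  "discrete_quasi_geodesic K L n x \<longleftrightarrow> (\<forall>i\<le>n. x i \<in> X) \<and>
     (\<forall>i j. i \<le> j \<longrightarrow> j \<le> n \<longrightarrow>
        j - i \<le> K * d (x i) (x j) + L \<and> d (x i) (x j) \<le> K * (j - i) + L)"

text \<open>
  Strong quasiconvexity, with the bound recorded as an explicit gauge \<open>\<mu>\<close>. All translates of a
  subgroup share one gauge, and every constant below depends on the sets only through it.
\<close>

definition morse_set :: "(nat \<Rightarrow> nat \<Rightarrow> nat) \<Rightarrow> 'p set \<Rightarrow> bool" where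
  "morse_set \<mu> Y \<longleftrightarrow> Y \<subseteq> X \<and> Y \<noteq> {} \<and>
     (\<forall>K\<ge>1. \<forall>L n x. discrete_quasi_geodesic K L n x \<and> x 0 \<in> Y \<and> x n \<in> Y
        \<longrightarrow> (\<forall>i\<le>n. dist_to Y (x i) \<le> \<mu> K L))"

lemma morse_setD:
  assumes "morse_set \<mu> Y" "K \<ge> 1" "discrete_quasi_geodesic K L n x" "x 0 \<in> Y" "x n \<in> Y" "i \<le> n"
  shows "dist_to Y (x i) \<le> \<mu> K L"
  using assms unfolding morse_set_def by blast

lemma morse_set_geodesic:
  assumes "morse_set \<mu> Y" "\<forall>i\<le>n. g i \<in> X" "\<forall>i j. i \<le> j \<longrightarrow> j \<le> n \<longrightarrow> d (g i) (g j) = j - i"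
    "g 0 \<in> Y" "g n \<in> Y" "i \<le> n"
  shows "dist_to Y (g i) \<le> \<mu> 1 0"
  using assms by (intro morse_setD[of \<mu> Y 1 0 n g]) (auto simp: discrete_quasi_geodesic_def)

text \<open>
  An end that is only near \<open>Y\<close> is replaced by a nearest point of \<open>Y\<close>, at the expense of the
  additive constant.
\<close>

lemma morse_set_end_nearby:
  assumes M: "morse_set \<mu> Y" and K: "K \<ge> 1" and x: "discrete_quasi_geodesic K L n x"
    and "x 0 \<in> Y" and D: "dist_to Y (x n) \<le> D" and "i \<le> n"
  shows "dist_to Y (x i) \<le> D + \<mu> K (L + K * D)"
proof (cases "i = n")
  case True
  then show ?thesis using D by simp
next
  case False
  have Y: "Y \<subseteq> X" "Y \<noteq> {}" using M by (auto simp: morse_set_def)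
  obtain y where y: "y \<in> Y" "d (x n) y \<le> D" using nearest_point_exists Y D by metis
  have D_le: "D \<le> K * D" using K by simp
  have "discrete_quasi_geodesic K (L + K * D) n (x(n := y))"
    unfolding discrete_quasi_geodesic_def
  proof (intro conjI allI impI)
    fix i assume "i \<le> n"
    then show "(x(n := y)) i \<in> X" using x y Y unfolding discrete_quasi_geodesic_def by auto
  next
    fix i j assume ij: "i \<le> j" "j \<le> n"
    have old: "j - i \<le> K * d (x i) (x j) + L" "d (x i) (x j) \<le> K * (j - i) + L"
      using x ij unfolding discrete_quasi_geodesic_def by auto
    have in_X: "x i \<in> X" "x n \<in> X" "y \<in> X"
      using x y Y ij unfolding discrete_quasi_geodesic_def by auto
    have new: "d (x i) (x n) \<le> d (x i) y + D" "d (x i) y \<le> d (x i) (x n) + D"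
      using d_triangle[of "x i" y "x n"] d_triangle[of "x i" "x n" y] d_sym[of y "x n"] in_X y by auto
    have "K * d (x i) (x n) \<le> K * d (x i) y + K * D"
      using mult_le_mono2[OF new(1), of K] by (simp add: distrib_left)
    then show "j - i \<le> K * d ((x(n := y)) i) ((x(n := y)) j) + (L + K * D)"
      using old ij by (cases "i = n"; cases "j = n") (auto simp: d_eq_0)
    show "d ((x(n := y)) i) ((x(n := y)) j) \<le> K * (j - i) + (L + K * D)"
    proof -
      consider "i = n" "j = n" | "i < n" "j = n" | "j < n" using ij by linarith
      then show ?thesis
      proof cases
        case 1
        then show ?thesis using d_eq_0[of y y] in_X by simp
      next
        case 2
        have "d (x i) y \<le> K * (n - i) + (L + K * D)" using old new D_le unfolding 2(2) by linarith
        then show ?thesis using 2 by simp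
      next
        case 3
        then show ?thesis using old ij by simp
      qed
    qed
  qed
  from morse_setD[OF M K this, of i] show ?thesis using False assms y by auto
qed


section \<open>Vertex weights and quasi-geodesics\<close>

text \<open>
  Quasi-geodesics are produced by changing the metric. If every step of a walk costs between \<open>1\<close>
  and \<open>k\<close>, then the cheapest walks are \<open>(k, 0)\<close>-quasi-geodesics for the original metric, whatever
  the weights are. This leaves the weights free to be adapted to a given set. A step is charged
  the weight of the vertex that it leaves, so the last vertex of a walk is free.
\<close>

inductive weighted_walk :: "('p \<Rightarrow> nat) \<Rightarrow> 'p \<Rightarrow> 'p \<Rightarrow> nat \<Rightarrow> bool" for w b where
  stay: "b \<in> X \<Longrightarrow> weighted_walk w b b 0"
| step: "\<lbrakk>weighted_walk w b v c; u \<in> X; v \<in> X; d u v = 1\<rbrakk> \<Longrightarrow> weighted_walk w b u (w u + c)"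

definition weighted_dist :: "('p \<Rightarrow> nat) \<Rightarrow> 'p \<Rightarrow> 'p \<Rightarrow> nat" where
  "weighted_dist w b u = (LEAST c. weighted_walk w b u c)"

lemma weighted_walk_exists:
  assumes "u \<in> X" "b \<in> X" shows "\<exists>c. weighted_walk w b u c"
  using assms
proof (induction "d u b" arbitrary: u)
  case 0
  then show ?case using d_eq_0 stay by metis
next
  case (Suc n)
  then obtain v where "v \<in> X" "d u v = 1" "d v b = n" using d_interpolate[of u b 1 n] by auto
  then show ?case using Suc step by metis
qed

lemma weighted_walk_dist:
  assumes "u \<in> X" "b \<in> X" shows "weighted_walk w b u (weighted_dist w b u)"
  unfolding weighted_dist_def using weighted_walk_exists[OF assms] by (rule LeastI_ex)

lemma weighted_dist_edge:
  assumes "u \<in> X" "v \<in> X" "b \<in> X" "d u v = 1"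
  shows "weighted_dist w b u \<le> w u + weighted_dist w b v"
  unfolding weighted_dist_def[of w b u]
  by (rule Least_le) (use assms step weighted_walk_dist in blast)

lemma weighted_dist_self: "b \<in> X \<Longrightarrow> weighted_dist w b b = 0"
  unfolding weighted_dist_def using stay by (metis Least_eq_0)

lemma weighted_dist_descent:
  assumes "u \<in> X" "b \<in> X" "u \<noteq> b"
  shows "\<exists>v\<in>X. d u v = 1 \<and> weighted_dist w b u = w u + weighted_dist w b v"
  using weighted_walk_dist[OF assms(1,2), of w]
proof cases
  case stay
  then show ?thesis using assms by simp
next
  case (step v c)
  have "weighted_dist w b v \<le> c"
    unfolding weighted_dist_def by (rule Least_le) (rule step)
  moreover have "weighted_dist w b u \<le> w u + weighted_dist w b v"
    using weighted_dist_edge step assms by blast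
  ultimately show ?thesis using step by (intro bexI[of _ v]) auto
qed

lemma weighted_dist_lipschitz:
  assumes "u \<in> X" "v \<in> X" "b \<in> X" "\<forall>x\<in>X. w x \<le> k"
  shows "weighted_dist w b u \<le> k * d u v + weighted_dist w b v"
  using assms(1)
proof (induction "d u v" arbitrary: u)
  case 0
  then show ?case using d_eq_0 assms by simp
next
  case (Suc n)
  then obtain u' where u': "u' \<in> X" "d u u' = 1" "d u' v = n"
    using d_interpolate[of u v 1 n] assms by auto
  then have "weighted_dist w b u' \<le> k * n + weighted_dist w b v" using Suc(1)[of u'] by simp
  moreover have "weighted_dist w b u \<le> w u + weighted_dist w b u'"
    using weighted_dist_edge u' Suc assms by blast
  moreover have "w u \<le> k" using assms(4) Suc by blast
  ultimately show ?case unfolding Suc(2)[symmetric] by simp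
qed

text \<open>
  A cheapest walk is obtained by following the function \<open>weighted_dist w b\<close> downhill. The sequence
  is characterised by this descent, which makes the cost of each of its sections a difference of
  two values of that function.
\<close>

lemma weighted_geodesic_exists:
  assumes "u \<in> X" "b \<in> X" "\<forall>x\<in>X. 1 \<le> w x"
  shows "\<exists>n x. x 0 = u \<and> x n = b \<and> (\<forall>i\<le>n. x i \<in> X) \<and>
    (\<forall>i<n. d (x i) (x (Suc i)) = 1 \<and>
       weighted_dist w b (x i) = w (x i) + weighted_dist w b (x (Suc i)))"
  using assms(1)
proof (induction "weighted_dist w b u" arbitrary: u rule: less_induct)
  case less
  show ?case
  proof (cases "u = b")
    case True
    then show ?thesis using assms by (intro exI[of _ 0] exI[of _ "\<lambda>_. b"]) auto
  next
    case False
    obtain v where v: "v \<in> X" "d u v = 1" "weighted_dist w b u = w u + weighted_dist w b v"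
      using weighted_dist_descent[of u b w] less(2) assms(2) False by blast
    have "weighted_dist w b v < weighted_dist w b u" using v(3) less(2) assms(3) by force
    from less(1)[OF this v(1)] obtain n x where x: "x 0 = v" "x n = b" "\<forall>i\<le>n. x i \<in> X"
      "\<forall>i<n. d (x i) (x (Suc i)) = 1 \<and>
         weighted_dist w b (x i) = w (x i) + weighted_dist w b (x (Suc i))" by blast
    show ?thesis
      by (intro exI[of _ "Suc n"] exI[of _ "case_nat u x"])
        (use x v less(2) in \<open>auto split: nat.split\<close>)
  qed
qed

text \<open>
  A section of a cheapest walk costs at least its length, since weights are at least \<open>1\<close>, and at
  most \<open>k\<close> times the distance of its ends, since it could be replaced by a geodesic.
\<close>

lemma weighted_geodesic_quasi_geodesic:
  assumes b: "b \<in> X" and w: "\<forall>v\<in>X. 1 \<le> w v \<and> w v \<le> k"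
    and in_X: "\<forall>i\<le>n. x i \<in> X"
    and x: "\<forall>i<n. d (x i) (x (Suc i)) = 1 \<and>
       weighted_dist w b (x i) = w (x i) + weighted_dist w b (x (Suc i))"
  shows "discrete_quasi_geodesic k 0 n x"
proof -
  have "1 \<le> k" using w b by force
  have steps: "weighted_dist w b (x i) \<ge> (j - i) + weighted_dist w b (x j) \<and> d (x i) (x j) \<le> j - i"
    if "i \<le> j" "j \<le> n" for i j
    using that
  proof (induction j rule: dec_induct)
    case base
    then show ?case using d_eq_0 in_X by simp
  next
    case (step j)
    then have "1 \<le> w (x j)" "d (x i) (x (Suc j)) \<le> d (x i) (x j) + d (x j) (x (Suc j))"
      using w in_X d_triangle by simp_all
    moreover have "d (x j) (x (Suc j)) = 1"
      "weighted_dist w b (x j) = w (x j) + weighted_dist w b (x (Suc j))"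
      using x step by auto
    ultimately show ?case using step by auto
  qed
  show ?thesis
    unfolding discrete_quasi_geodesic_def
  proof (intro conjI allI impI)
    fix i j assume ij: "i \<le> j" "j \<le> n"
    have "weighted_dist w b (x i) \<le> k * d (x i) (x j) + weighted_dist w b (x j)"
      using weighted_dist_lipschitz w in_X b ij by auto
    then show "j - i \<le> k * d (x i) (x j) + 0" using steps[OF ij] by simp
    have "j - i \<le> k * (j - i)" using \<open>1 \<le> k\<close> by simp
    then show "d (x i) (x j) \<le> k * (j - i) + 0" using steps[OF ij] by linarith
  qed (use in_X in auto)
qed


section \<open>Projections to Morse sets contract\<close>

text \<open>
  Steps that start close to \<open>Y\<close> are expensive. If \<open>M\<close> bounds how far \<open>(k, 0)\<close>-quasi-geodesics
  between points of \<open>Y\<close> stray from \<open>Y\<close>, then a cheapest walk between two such points nevertheless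
  has to stay in the expensive region, and no detour away from \<open>Y\<close> can be cheaper.
\<close>

definition tax :: "nat \<Rightarrow> nat \<Rightarrow> 'p set \<Rightarrow> 'p \<Rightarrow> nat" where
  "tax k M Y v = (if dist_to Y v \<le> M then k else 1)"

text \<open>
  Under the hypothesis \<open>d u v \<le> dist_to Y u\<close>, the vertex \<open>i\<close> steps after \<open>u\<close> on a geodesic to \<open>v\<close>
  has distance at least \<open>d u v - i\<close> from \<open>Y\<close>. Hence all but the last \<open>M + 1\<close> vertices are cheap, in
  both directions of travel.
\<close>

lemma tax_walk_cheap:
  assumes Y: "Y \<subseteq> X" "Y \<noteq> {}" and b: "b \<in> X" and k: "1 \<le> k"
    and "u \<in> X" "v \<in> X" "d u v \<le> dist_to Y u"
  shows "weighted_dist (tax k M Y) b u \<le> d u v + k * (M + 1) + weighted_dist (tax k M Y) b v \<and>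
         weighted_dist (tax k M Y) b v \<le> d u v + k * (M + 1) + weighted_dist (tax k M Y) b u"
  using assms(5-)
proof (induction "d u v" arbitrary: u)
  case 0
  then show ?case using d_eq_0 by simp
next
  case (Suc m)
  let ?w = "tax k M Y" let ?f = "weighted_dist (tax k M Y) b"
  have w_le: "\<forall>x\<in>X. ?w x \<le> k" using k by (simp add: tax_def)
  show ?case
  proof (cases "Suc m \<le> M + 1")
    case True
    have "k * d u v \<le> k * (M + 1)" using True Suc(2) by (metis mult_le_mono2)
    then show ?thesis
      using weighted_dist_lipschitz[OF Suc(3,4) b w_le] weighted_dist_lipschitz[OF Suc(4,3) b w_le]
        d_sym[OF Suc(3,4)] by simp
  next
    case False
    obtain u' where u': "u' \<in> X" "d u u' = 1" "d u' v = m"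
      using d_interpolate[of u v 1 m] Suc by auto
    have near: "m \<le> dist_to Y u'"
      using dist_to_lipschitz[OF Y Suc(3) u'(1)] u' Suc by simp
    have "?w u = 1" "?w u' = 1" using near False Suc by (auto simp: tax_def)
    then have "?f u \<le> 1 + ?f u'" "?f u' \<le> 1 + ?f u"
      using weighted_dist_edge[of u u' b ?w] weighted_dist_edge[of u' u b ?w] u' Suc b d_sym[of u u']
      by auto
    then show ?thesis using Suc(1)[of u'] u' near Suc by auto
  qed
qed

text \<open>
  The ball about \<open>z\<close> that just reaches \<open>Y\<close> has a small projection to \<open>Y\<close>. The cheapest walk from
  \<open>p\<close> to \<open>q'\<close> stays in the expensive region and thus costs at least \<open>k * d p q'\<close>. It competes with
  the walk from \<open>p\<close> over \<open>z\<close> and \<open>q\<close> to \<open>q'\<close>, whose three legs have total length at most four times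
  the distance from \<open>z\<close> to \<open>Y\<close> and meet the expensive region only briefly. Large \<open>k\<close> makes the
  contraction factor \<open>4 / k\<close> small.
\<close>

lemma morse_projection_contracts:
  assumes M: "morse_set \<mu> Y" and k: "1 \<le> k"
    and pts: "z \<in> X" "q \<in> X" "p \<in> Y" "q' \<in> Y"
    and near: "d z p = dist_to Y z" "d q q' = dist_to Y q"
    and ball: "d z q \<le> dist_to Y z"
  shows "k * d p q' \<le> 4 * dist_to Y z + 3 * (k * (\<mu> k 0 + 1))"
proof -
  have Y: "Y \<subseteq> X" "Y \<noteq> {}" using M by (auto simp: morse_set_def)
  have in_X: "p \<in> X" "q' \<in> X" using pts Y by auto
  let ?w = "tax k (\<mu> k 0) Y"
  let ?f = "weighted_dist ?w q'"
  have w: "\<forall>v\<in>X. 1 \<le> ?w v \<and> ?w v \<le> k" using k by (simp add: tax_def)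
  obtain n x where x: "x 0 = p" "x n = q'" "\<forall>i\<le>n. x i \<in> X"
      "\<forall>i<n. d (x i) (x (Suc i)) = 1 \<and> ?f (x i) = ?w (x i) + ?f (x (Suc i))"
    using weighted_geodesic_exists[OF in_X, of ?w] w by blast
  have qg: "discrete_quasi_geodesic k 0 n x"
    by (rule weighted_geodesic_quasi_geodesic[OF in_X(2) w x(3,4)])
  have "dist_to Y (x i) \<le> \<mu> k 0" if "i \<le> n" for i
    using morse_setD[OF M k qg] x pts that by auto
  then have full: "?w (x i) = k" if "i \<le> n" for i using that by (simp add: tax_def)
  have "?f p = k * i + ?f (x i) \<and> d p (x i) \<le> i" if "i \<le> n" for i
    using that
  proof (induction i)
    case 0
    then show ?case using x in_X d_eq_0 by simp
  next
    case (Suc i)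
    then show ?case
      using x full[of i] d_triangle[of p "x i" "x (Suc i)"] in_X by auto
  qed
  from this[of n] have "k * d p q' \<le> ?f p"
    using x k by (simp add: weighted_dist_self in_X)
  moreover have "?f p \<le> dist_to Y z + k * (\<mu> k 0 + 1) + ?f z"
    using tax_walk_cheap[OF Y in_X(2) k pts(1) in_X(1)] near by auto
  moreover have "?f z \<le> dist_to Y z + k * (\<mu> k 0 + 1) + ?f q"
    using tax_walk_cheap[OF Y in_X(2) k pts(1,2) ball] ball by (meson add_le_mono le_refl order_trans)
  moreover have "?f q \<le> dist_to Y q + k * (\<mu> k 0 + 1)"
    using tax_walk_cheap[OF Y in_X(2) k pts(2) in_X(2)] near by (auto simp: weighted_dist_self in_X)
  moreover have "dist_to Y q \<le> 2 * dist_to Y z"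
    using dist_to_lipschitz[OF Y pts(2,1)] d_sym[of z q] pts ball by simp
  ultimately show ?thesis by linarith
qed


section \<open>A coarse Helly property\<close>

text \<open>
  A geodesic from \<open>q\<close> to its projection \<open>q'\<close>, followed by a geodesic inside a neighbourhood of \<open>Y\<close>,
  is a quasi-geodesic: a point \<open>u\<close> of the first part has \<open>q'\<close> among its nearest points in \<open>Y\<close>, so
  it is about as far from the second part as from \<open>q'\<close>. Both ends are near \<open>Z\<close>, hence so is \<open>q'\<close>.
\<close>

lemma projection_near_other_set:
  assumes M: "morse_set \<mu> Y" "morse_set \<mu> Z"
    and "q \<in> Z" "q' \<in> Y" "d q q' = dist_to Y q"
    and "y \<in> Y" "dist_to Z y \<le> D"
  shows "dist_to Z q' \<le> D + \<mu> 3 (2 * \<mu> 1 0 + 3 * D)"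
proof -
  have Y: "Y \<subseteq> X" "Y \<noteq> {}" "Z \<subseteq> X" using M by (auto simp: morse_set_def)
  have in_X: "q \<in> X" "q' \<in> X" "y \<in> X" using assms Y by auto
  define m where "m = d q q'"
  define n where "n = d q' y"
  obtain g where g: "g 0 = q" "g m = q'" "\<forall>i\<le>m. g i \<in> X"
      "\<forall>i j. i \<le> j \<longrightarrow> j \<le> m \<longrightarrow> d (g i) (g j) = j - i"
    using geodesic_exists[OF in_X(1,2)] unfolding m_def by blast
  obtain h where h: "h 0 = q'" "h n = y" "\<forall>i\<le>n. h i \<in> X"
      "\<forall>i j. i \<le> j \<longrightarrow> j \<le> n \<longrightarrow> d (h i) (h j) = j - i"
    using geodesic_exists[OF in_X(2,3)] unfolding n_def by blast
  define x where "x i = (if i \<le> m then g i else h (i - m))" for i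
  have cross: "(m - i) + j \<le> 3 * d (g i) (h j) + 2 * \<mu> 1 0 \<and> d (g i) (h j) \<le> (m - i) + j"
    if ij: "i \<le> m" "j \<le> n" for i j
  proof -
    have gh: "g i \<in> X" "h j \<in> X" using g h ij by auto
    have "dist_to Y (h j) \<le> \<mu> 1 0"
      using morse_set_geodesic[OF M(1) h(3,4)] h assms ij by simp
    then have "dist_to Y (g i) \<le> d (g i) (h j) + \<mu> 1 0"
      using dist_to_lipschitz[OF Y(1,2) gh] by simp
    moreover have "m \<le> i + dist_to Y (g i)"
      using dist_to_lipschitz[OF Y(1,2) in_X(1) gh(1)] assms(5) g(4)[rule_format, of 0 i] g(1) ij
      by (simp add: m_def)
    moreover have "d (g i) q' = m - i" "d q' (h j) = j"
      using g(2,4) h(1,4) ij by (auto dest: spec[of _ 0])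
    moreover have "d q' (h j) \<le> d q' (g i) + d (g i) (h j)" "d (g i) (h j) \<le> d (g i) q' + d q' (h j)"
      using d_triangle gh in_X by auto
    moreover have "d q' (g i) = d (g i) q'" using d_sym gh in_X by simp
    ultimately show ?thesis by linarith
  qed
  have "discrete_quasi_geodesic 3 (2 * \<mu> 1 0) (m + n) x"
    unfolding discrete_quasi_geodesic_def
  proof (intro conjI allI impI)
    fix i assume "i \<le> m + n"
    then show "x i \<in> X" using g h by (auto simp: x_def)
  next
    fix i j assume ij: "i \<le> j" "j \<le> m + n"
    consider "j \<le> m" | "m < i" | "i \<le> m" "m < j" by linarith
    then have "j - i \<le> 3 * d (x i) (x j) + 2 * \<mu> 1 0 \<and> d (x i) (x j) \<le> j - i"
    proof cases
      case 1
      then show ?thesis using ij g(4) by (simp add: x_def)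
    next
      case 2
      then show ?thesis using ij h(4)[rule_format, of "i - m" "j - m"] by (simp add: x_def)
    next
      case 3
      then show ?thesis using ij cross[of i "j - m"] by (simp add: x_def)
    qed
    then show "j - i \<le> 3 * d (x i) (x j) + 2 * \<mu> 1 0"
      "d (x i) (x j) \<le> 3 * (j - i) + 2 * \<mu> 1 0" by auto
  qed
  moreover have "x (m + n) = y" using g h by (cases "n = 0") (auto simp: x_def)
  ultimately have "dist_to Z (x m) \<le> D + \<mu> 3 (2 * \<mu> 1 0 + 3 * D)"
    using morse_set_end_nearby[OF M(2), of 3 "2 * \<mu> 1 0" "m + n" x D m] assms g by (simp add: x_def)
  then show ?thesis using g by (simp add: x_def)
qed

text \<open>
  The largest solution \<open>R\<close> of \<open>2 * R \<le> R + helly_radius \<mu> D\<close>, the inequality that a minimal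
  covering radius satisfies in the next proof.
\<close>

definition helly_radius :: "(nat \<Rightarrow> nat \<Rightarrow> nat) \<Rightarrow> nat \<Rightarrow> nat" where
  "helly_radius \<mu> D = 6 * (\<mu> 8 0 + 1) + 2 * (D + \<mu> 3 (2 * \<mu> 1 0 + 3 * D))"

text \<open>
  Let \<open>z\<close> minimise the maximal distance \<open>R\<close> to the sets of the family, let \<open>Y\<close> be a set at
  distance \<open>R\<close>, and let \<open>p\<close> be the projection of \<open>z\<close> to \<open>Y\<close>. For every other set \<open>Z\<close>, the
  projection \<open>q\<close> of \<open>z\<close> to \<open>Z\<close> lies in the ball of radius \<open>R\<close> about \<open>z\<close>, so its projection \<open>q'\<close> to
  \<open>Y\<close> is within \<open>R / 2\<close> of \<open>p\<close>, up to a constant; and \<open>q'\<close> is near \<open>Z\<close> because \<open>Y\<close> and \<open>Z\<close> are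
  close to each other. So \<open>p\<close> is within \<open>R / 2\<close> plus a constant of every set, and minimality of
  \<open>R\<close> bounds \<open>R\<close>. The bound does not depend on the number of sets.
\<close>

lemma morse_sets_coarse_helly:
  assumes F: "finite F" "F \<noteq> {}" and M: "\<And>Y. Y \<in> F \<Longrightarrow> morse_set \<mu> Y"
    and close: "\<And>Y Z. \<lbrakk>Y \<in> F; Z \<in> F\<rbrakk> \<Longrightarrow> \<exists>y\<in>Y. dist_to Z y \<le> D"
  shows "\<exists>z\<in>X. \<forall>Y\<in>F. dist_to Y z \<le> helly_radius \<mu> D"
proof -
  define ecc where "ecc z = Max ((\<lambda>Y. dist_to Y z) ` F)" for z
  have le_ecc: "dist_to Y z \<le> ecc z" if "Y \<in> F" for Y z
    unfolding ecc_def using F that by simp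
  have ecc_attained: "\<exists>Y\<in>F. dist_to Y z = ecc z" for z
  proof -
    have "ecc z \<in> (\<lambda>Y. dist_to Y z) ` F" unfolding ecc_def using F by (intro Max_in) auto
    then show ?thesis by force
  qed
  obtain Y0 where Y0: "Y0 \<in> F" using F by blast
  have sub: "Y \<subseteq> X \<and> Y \<noteq> {}" if "Y \<in> F" for Y using M[OF that] by (simp add: morse_set_def)
  obtain z where z: "z \<in> X" and min: "\<And>y. y \<in> X \<Longrightarrow> ecc z \<le> ecc y"
    using ex_has_least_nat[of "\<lambda>z. z \<in> X" _ ecc] sub[OF Y0] by blast
  obtain Y where Y: "Y \<in> F" "dist_to Y z = ecc z" using ecc_attained by blast
  obtain p where p: "p \<in> Y" "d z p = dist_to Y z" using nearest_point_exists sub Y by metis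
  then have pX: "p \<in> X" using sub Y by blast
  obtain Z where Z: "Z \<in> F" "dist_to Z p = ecc p" using ecc_attained by blast
  obtain q where q: "q \<in> Z" "d z q = dist_to Z z" using nearest_point_exists sub Z by metis
  then have qX: "q \<in> X" using sub Z by blast
  obtain q' where q': "q' \<in> Y" "d q q' = dist_to Y q" using nearest_point_exists sub Y by metis
  then have q'X: "q' \<in> X" using sub Y by blast
  obtain y where y: "y \<in> Y" "dist_to Z y \<le> D" using close Y Z by blast
  \<comment> \<open>The factor \<open>8\<close> is twice the \<open>4\<close> of the contraction estimate, which gives the ratio \<open>1 / 2\<close>.\<close>
  have "8 * d p q' \<le> 4 * ecc z + 3 * (8 * (\<mu> 8 0 + 1))"
    using morse_projection_contracts[OF M[OF Y(1)] _ z qX p(1) q'(1) p(2) q'(2), of 8]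
      q Y le_ecc[OF Z(1)] by simp
  moreover have "dist_to Z q' \<le> D + \<mu> 3 (2 * \<mu> 1 0 + 3 * D)"
    by (rule projection_near_other_set[OF M[OF Y(1)] M[OF Z(1)] q(1) q' y])
  moreover have "ecc p \<le> d p q' + dist_to Z q'"
    using dist_to_lipschitz[of Z p q'] sub Z pX q'X by auto
  moreover have "ecc z \<le> ecc p" using min pX by blast
  ultimately have "ecc z \<le> helly_radius \<mu> D" unfolding helly_radius_def by simp
  then show ?thesis using z le_ecc order_trans by blast
qed


section \<open>Crossing sets have close boundaries\<close>

text \<open>
  Both ends of a boundary edge are constrained, so that the notion is invariant under complements.
\<close>

definition coboundary_within :: "nat \<Rightarrow> 'p set \<Rightarrow> 'p set \<Rightarrow> bool" where
  "coboundary_within r Y B \<longleftrightarrow>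
     (\<forall>u\<in>X. \<forall>v\<in>X. d u v = 1 \<longrightarrow> u \<in> B \<longrightarrow> v \<notin> B \<longrightarrow> dist_to Y u \<le> r \<and> dist_to Y v \<le> r)"

lemma coboundary_within_compl:
  "coboundary_within r Y B \<Longrightarrow> coboundary_within r Y (X - B)"
  unfolding coboundary_within_def using d_sym by (metis DiffD2 DiffI)

lemma same_side_along_geodesic:
  assumes C: "coboundary_within r Z C"
    and x: "\<forall>i\<le>n. x i \<in> X" "\<forall>i j. i \<le> j \<longrightarrow> j \<le> n \<longrightarrow> d (x i) (x j) = j - i"
    and far: "\<And>i. i \<le> n \<Longrightarrow> r < dist_to Z (x i)"
  shows "x 0 \<in> C \<longleftrightarrow> x n \<in> C"
proof -
  have "x 0 \<in> C \<longleftrightarrow> x i \<in> C" if "i \<le> n" for i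
    using that
  proof (induction i)
    case (Suc i)
    then have "d (x i) (x (Suc i)) = 1" "x i \<in> X" "x (Suc i) \<in> X" "r < dist_to Z (x i)"
      using x far by auto
    then have "x i \<in> C \<longleftrightarrow> x (Suc i) \<in> C"
      using C d_sym[of "x i" "x (Suc i)"] unfolding coboundary_within_def by (metis leD)
    then show ?case using Suc by simp
  qed simp
  then show ?thesis by simp
qed

text \<open>
  Morse sets are coarsely connected: the \<open>r\<close>-neighbourhood of \<open>Y\<close> is connected, because any of its
  points is joined inside it to \<open>Y\<close> by a shortest path, and two points of \<open>Y\<close> by a geodesic. If it
  misses the \<open>r\<close>-neighbourhood of \<open>Z\<close>, it cannot cross the boundary of \<open>C\<close>.
\<close>

lemma morse_set_one_side:
  assumes M: "morse_set \<mu> Y" and r: "\<mu> 1 0 \<le> r" and C: "coboundary_within r Z C"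
    and far: "\<And>v. \<lbrakk>v \<in> X; dist_to Y v \<le> r\<rbrakk> \<Longrightarrow> r < dist_to Z v"
    and "u \<in> X" "v \<in> X" "dist_to Y u \<le> r" "dist_to Y v \<le> r"
  shows "u \<in> C \<longleftrightarrow> v \<in> C"
proof -
  have Y: "Y \<subseteq> X" "Y \<noteq> {}" using M by (auto simp: morse_set_def)
  have to_Y: "\<exists>y\<in>Y. u \<in> C \<longleftrightarrow> y \<in> C" if u: "u \<in> X" "dist_to Y u \<le> r" for u
  proof -
    obtain y where y: "y \<in> Y" "d u y = dist_to Y u" using nearest_point_exists Y by blast
    then have "y \<in> X" using Y by blast
    obtain g where g: "g 0 = u" "g (d u y) = y" "\<forall>i\<le>d u y. g i \<in> X"
        "\<forall>i j. i \<le> j \<longrightarrow> j \<le> d u y \<longrightarrow> d (g i) (g j) = j - i"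
      using geodesic_exists[OF u(1) \<open>y \<in> X\<close>] by blast
    have "r < dist_to Z (g i)" if i: "i \<le> d u y" for i
    proof (rule far)
      have "d (g i) y = d u y - i" using g(2,4) i by (metis le_refl)
      then show "dist_to Y (g i) \<le> r" using dist_to_le[OF y(1), of "g i"] y(2) u(2) by simp
    qed (use g i in auto)
    then show ?thesis using same_side_along_geodesic[OF C g(3,4)] g(1,2) y(1) by metis
  qed
  have in_Y: "y \<in> C \<longleftrightarrow> y' \<in> C" if yy: "y \<in> Y" "y' \<in> Y" for y y'
  proof -
    have yX: "y \<in> X" "y' \<in> X" using yy Y by auto
    obtain g where g: "g 0 = y" "g (d y y') = y'" "\<forall>i\<le>d y y'. g i \<in> X"
        "\<forall>i j. i \<le> j \<longrightarrow> j \<le> d y y' \<longrightarrow> d (g i) (g j) = j - i"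
      using geodesic_exists[OF yX] by blast
    have "r < dist_to Z (g i)" if i: "i \<le> d y y'" for i
      using far morse_set_geodesic[OF M g(3,4) _ _ i] g(1,2,3) yy i r by fastforce
    then show ?thesis using same_side_along_geodesic[OF C g(3,4)] g(1,2) by metis
  qed
  show ?thesis using to_Y in_Y assms by metis
qed

text \<open>
  A path from \<open>B \<inter> C\<close> to a point of \<open>Y\<close>, which lies outside \<open>C\<close>, would have to leave the corner
  through the boundary of \<open>B\<close>, which lies near \<open>Y\<close> and hence outside \<open>C\<close>, or through the boundary
  of \<open>C\<close>, which lies near \<open>Z\<close> and hence outside \<open>B\<close>.
\<close>

lemma empty_corner:
  assumes B: "coboundary_within r Y B" and C: "coboundary_within r Z C"
    and Y: "Y \<subseteq> X" "Y \<noteq> {}"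
    and YC: "\<And>v. \<lbrakk>v \<in> X; dist_to Y v \<le> r\<rbrakk> \<Longrightarrow> v \<notin> C"
    and ZB: "\<And>v. \<lbrakk>v \<in> X; dist_to Z v \<le> r\<rbrakk> \<Longrightarrow> v \<notin> B"
  shows "X \<inter> B \<inter> C = {}"
proof (rule ccontr)
  assume "X \<inter> B \<inter> C \<noteq> {}"
  then obtain u where u: "u \<in> X" "u \<in> B" "u \<in> C" by blast
  obtain y where y: "y \<in> Y" using Y by blast
  have "y \<in> X" using Y y by blast
  have "y \<notin> C" using YC[OF \<open>y \<in> X\<close>] dist_to_eq_0[OF y \<open>y \<in> X\<close>] by simp
  obtain g where g: "g 0 = u" "g (d u y) = y" "\<forall>i\<le>d u y. g i \<in> X"
      "\<forall>i j. i \<le> j \<longrightarrow> j \<le> d u y \<longrightarrow> d (g i) (g j) = j - i"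
    using geodesic_exists[OF u(1) \<open>y \<in> X\<close>] by blast
  have "g i \<in> B \<inter> C" if "i \<le> d u y" for i
    using that
  proof (induction i)
    case (Suc i)
    then have i: "d (g i) (g (Suc i)) = 1" "g i \<in> X" "g (Suc i) \<in> X" "g i \<in> B" "g i \<in> C"
      using g by auto
    have "g (Suc i) \<in> B" using B YC[of "g i"] i unfolding coboundary_within_def by metis
    moreover have "g (Suc i) \<in> C" using C ZB[of "g i"] i unfolding coboundary_within_def by metis
    ultimately show ?case by simp
  qed (use u g in simp)
  from this[of "d u y"] show False using g(2) \<open>y \<notin> C\<close> by simp
qed

text \<open>
  If \<open>Y\<close> and \<open>Z\<close> are far apart, a neighbourhood of each lies on one side of the set belonging to the
  other; the corner opposite to both neighbourhoods is then empty.
\<close>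

lemma crossing_sets_close:
  assumes M: "morse_set \<mu> Y" "morse_set \<mu> Z" and r: "\<mu> 1 0 \<le> r"
    and B: "coboundary_within r Y B" and C: "coboundary_within r Z C"
    and BC: "B \<subseteq> X" "C \<subseteq> X"
    and corners: "B \<inter> C \<noteq> {}" "B - C \<noteq> {}" "C - B \<noteq> {}" "X - B - C \<noteq> {}"
  shows "\<exists>y\<in>Y. dist_to Z y \<le> 2 * r"
proof (rule ccontr)
  assume not: "\<not> ?thesis"
  have Y: "Y \<subseteq> X" "Y \<noteq> {}" and Z: "Z \<subseteq> X" "Z \<noteq> {}" using M by (auto simp: morse_set_def)
  have farZ: "r < dist_to Z v" if v: "v \<in> X" "dist_to Y v \<le> r" for v
  proof -
    obtain y where y: "y \<in> Y" "d v y = dist_to Y v" using nearest_point_exists Y by blast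
    then have "dist_to Z y \<le> d v y + dist_to Z v"
      using dist_to_lipschitz[OF Z, of y v] d_sym[of v y] v Y by auto
    then show ?thesis using not y v by fastforce
  qed
  have farY: "r < dist_to Y v" if "v \<in> X" "dist_to Z v \<le> r" for v
    using farZ[of v] that by linarith
  note Y_side = morse_set_one_side[OF M(1) r C farZ]
  note Z_side = morse_set_one_side[OF M(2) r B farY]
  have "(\<forall>v\<in>X. dist_to Y v \<le> r \<longrightarrow> v \<notin> C) \<or> (\<forall>v\<in>X. dist_to Y v \<le> r \<longrightarrow> v \<notin> X - C)"
    using Y_side by blast
  then obtain C' where C': "C' = C \<or> C' = X - C" "\<forall>v\<in>X. dist_to Y v \<le> r \<longrightarrow> v \<notin> C'" by blast
  have "(\<forall>v\<in>X. dist_to Z v \<le> r \<longrightarrow> v \<notin> B) \<or> (\<forall>v\<in>X. dist_to Z v \<le> r \<longrightarrow> v \<notin> X - B)"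
    using Z_side by blast
  then obtain B' where B': "B' = B \<or> B' = X - B" "\<forall>v\<in>X. dist_to Z v \<le> r \<longrightarrow> v \<notin> B'" by blast
  have "coboundary_within r Y B'" "coboundary_within r Z C'"
    using B' C' B C coboundary_within_compl by auto
  from empty_corner[OF this Y] have "X \<inter> B' \<inter> C' = {}" using B' C' by blast
  moreover have "X \<inter> B' \<inter> C' \<noteq> {}"
  proof -
    have "X \<inter> B \<inter> C \<noteq> {}" "X \<inter> B \<inter> (X - C) \<noteq> {}" "X \<inter> (X - B) \<inter> C \<noteq> {}"
      "X \<inter> (X - B) \<inter> (X - C) \<noteq> {}"
      using corners BC by blast+
    then show ?thesis using B'(1) C'(1) by (elim disjE) simp_all
  qed
  ultimately show False by simp
qed

end


section \<open>From graphs and their realizations to integer metrics\<close>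

lemma adjacency_sym: "(u, v) \<in> adjacency \<Gamma> \<Longrightarrow> (v, u) \<in> adjacency \<Gamma>"
  by (auto simp: adjacency_def insert_commute)

lemma relpow_adjacency_sym:
  "(u, v) \<in> adjacency \<Gamma> ^^ n \<Longrightarrow> (v, u) \<in> adjacency \<Gamma> ^^ n"
proof (induction n arbitrary: v)
  case (Suc n)
  then obtain w where "(u, w) \<in> adjacency \<Gamma> ^^ n" "(w, v) \<in> adjacency \<Gamma>" by auto
  then show ?case using Suc adjacency_sym relpow_Suc_I2 by metis
qed simp

lemma graph_dist_le: "(u, v) \<in> adjacency \<Gamma> ^^ n \<Longrightarrow> graph_dist \<Gamma> u v \<le> n"
  unfolding graph_dist_def by (rule Least_le)

lemma graph_dist_walk:
  "(u, v) \<in> (adjacency \<Gamma>)\<^sup>* \<Longrightarrow> (u, v) \<in> adjacency \<Gamma> ^^ graph_dist \<Gamma> u v"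
  unfolding graph_dist_def by (rule LeastI_ex) (rule rtrancl_imp_relpow)

lemma graph_dist_geodesic:
  assumes adj: "adjacency \<Gamma> \<subseteq> X \<times> X"
    and conn: "\<And>u v. \<lbrakk>u \<in> X; v \<in> X\<rbrakk> \<Longrightarrow> (u, v) \<in> (adjacency \<Gamma>)\<^sup>*"
  shows "geodesic_graph_metric X (graph_dist \<Gamma>)"
proof
  note walk = graph_dist_walk[OF conn]
  show "graph_dist \<Gamma> x y = 0 \<longleftrightarrow> x = y" if "x \<in> X" "y \<in> X" for x y
    using walk[OF that] graph_dist_le[of x y 0 \<Gamma>] by auto
  show "graph_dist \<Gamma> x y = graph_dist \<Gamma> y x" if "x \<in> X" "y \<in> X" for x y
    using graph_dist_le[OF relpow_adjacency_sym[OF walk[OF that]]]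
      graph_dist_le[OF relpow_adjacency_sym[OF walk[OF that(2,1)]]] by (rule antisym[rotated])
  show triangle: "graph_dist \<Gamma> x z \<le> graph_dist \<Gamma> x y + graph_dist \<Gamma> y z"
    if "x \<in> X" "y \<in> X" "z \<in> X" for x y z
  proof (rule graph_dist_le)
    show "(x, z) \<in> adjacency \<Gamma> ^^ (graph_dist \<Gamma> x y + graph_dist \<Gamma> y z)"
      unfolding relpow_add using walk that by blast
  qed
  show "\<exists>z\<in>X. graph_dist \<Gamma> x z = m \<and> graph_dist \<Gamma> z y = n"
    if xy: "x \<in> X" "y \<in> X" "graph_dist \<Gamma> x y = m + n" for x y m n
  proof -
    have "(x, y) \<in> adjacency \<Gamma> ^^ m O adjacency \<Gamma> ^^ n"
      using walk[OF xy(1,2)] unfolding xy(3) relpow_add .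
    then obtain z where z: "(x, z) \<in> adjacency \<Gamma> ^^ m" "(z, y) \<in> adjacency \<Gamma> ^^ n" by blast
    have "(x, z) \<in> (adjacency \<Gamma>)\<^sup>*" using z(1) by (rule relpow_imp_rtrancl)
    then have "z \<in> X" using xy(1) adj by (induction rule: rtrancl_induct) auto
    then show ?thesis
      using triangle[OF xy(1) _ xy(2), of z] graph_dist_le[OF z(1)] graph_dist_le[OF z(2)] xy(3)
      by (intro bexI[of _ z]) auto
  qed
qed

lemma support_vertex: "support (indicator {v} :: 'v \<Rightarrow> real) = {v}"
  by (auto simp: support_def indicator_def)

lemma vertex_in_realization:
  "v \<in> verts \<Gamma> \<Longrightarrow> (indicator {v} :: 'v \<Rightarrow> real) \<in> realization \<Gamma>"
  by (auto simp: realization_def support_vertex)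

lemma realization_dist_vertices:
  assumes edges: "\<And>e. e \<in> edges \<Gamma> \<Longrightarrow> \<exists>a b. a \<noteq> b \<and> e = {a, b}"
    and metric: "geodesic_graph_metric X (graph_dist \<Gamma>)" and X: "u \<in> X" "v \<in> X"
  shows "realization_dist \<Gamma> (indicator {u}) (indicator {v}) = real (graph_dist \<Gamma> u v)"
proof -
  have zero: "graph_dist \<Gamma> u v = 0 \<longleftrightarrow> u = v"
    using geodesic_graph_metric.d_eq_0[OF metric X] .
  show ?thesis
  proof (cases "\<exists>e\<in>edges \<Gamma>. {u} \<union> {v} \<subseteq> e")
    case True
    then have dist: "realization_dist \<Gamma> (indicator {u}) (indicator {v}) =
        (\<Sum>w\<in>{u, v}. \<bar>indicator {u} w - indicator {v} w\<bar>) / 2"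
      unfolding realization_dist_def support_vertex using True by (simp only: if_True) (simp add: insert_commute)
    show ?thesis
    proof (cases "u = v")
      case False
      then have "(u, v) \<in> adjacency \<Gamma>"
        using True edges by (fastforce simp: adjacency_def doubleton_eq_iff insert_commute)
      then have "(u, v) \<in> adjacency \<Gamma> ^^ 1" by simp
      then have "graph_dist \<Gamma> u v \<le> 1" by (rule graph_dist_le)
      then have "graph_dist \<Gamma> u v = 1" using zero False by simp
      then show ?thesis using False unfolding dist by simp
    qed (use dist zero in simp)
  next
    case False
    then have "realization_dist \<Gamma> (indicator {u}) (indicator {v}) =
        Min {(1 - indicator {u} a) + real (graph_dist \<Gamma> a b) + (1 - indicator {v} b) | a b.
          a \<in> {u} \<and> b \<in> {v}}"
      unfolding realization_dist_def support_vertex by (simp only: if_False)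
    then show ?thesis by simp
  qed
qed

text \<open>
  The sequence is extended to real times as a step function. Rounding changes time differences by
  at most \<open>1\<close>, which the larger additive constant \<open>K + L\<close> absorbs.
\<close>

lemma discrete_quasi_geodesic_extends:
  assumes edges: "\<And>e. e \<in> edges \<Gamma> \<Longrightarrow> \<exists>a b. a \<noteq> b \<and> e = {a, b}"
    and metric: "geodesic_graph_metric (verts \<Gamma>) (graph_dist \<Gamma>)"
    and K: "K \<ge> 1"
    and x: "geodesic_graph_metric.discrete_quasi_geodesic (verts \<Gamma>) (graph_dist \<Gamma>) K L n x"
  shows "quasi_geodesic (realization \<Gamma>) (realization_dist \<Gamma>) (real K) (real (K + L)) {0..real n}
    (\<lambda>t. indicator {x (nat \<lfloor>t\<rfloor>)})"
  unfolding quasi_geodesic_def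
proof (intro conjI ballI)
  interpret geodesic_graph_metric "verts \<Gamma>" "graph_dist \<Gamma>" by (rule metric)
  let ?i = "\<lambda>t. nat \<lfloor>t\<rfloor>"
  have index: "?i t \<le> n" "real (?i t) \<le> t" "t < real (?i t) + 1" if "t \<in> {0..real n}" for t :: real
    using that by (auto simp: nat_le_iff floor_le_iff)
  have in_verts: "x i \<in> verts \<Gamma>" if "i \<le> n" for i
    using x that by (simp add: discrete_quasi_geodesic_def)
  show "is_interval {0..real n}" by (auto simp: is_interval_1)
  show "(\<lambda>t. indicator {x (?i t)}) ` {0..real n} \<subseteq> realization \<Gamma>"
    by (intro image_subsetI vertex_in_realization in_verts index(1))
  have bounds: "1 / real K * \<bar>s - t\<bar> - real (K + L) \<le> real (graph_dist \<Gamma> (x (?i s)) (x (?i t))) \<and>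
      real (graph_dist \<Gamma> (x (?i s)) (x (?i t))) \<le> real K * \<bar>s - t\<bar> + real (K + L)"
    if "s \<in> {0..real n}" "t \<in> {0..real n}" "s \<le> t" for s t :: real
  proof -
    let ?D = "graph_dist \<Gamma> (x (?i s)) (x (?i t))"
    have ij: "?i s \<le> ?i t" "?i t \<le> n" using that index by (auto intro: nat_mono floor_mono)
    then have "?i t - ?i s \<le> K * ?D + L" "?D \<le> K * (?i t - ?i s) + L"
      using x by (auto simp: discrete_quasi_geodesic_def)
    then have D: "real (?i t - ?i s) \<le> real K * real ?D + real L"
        "real ?D \<le> real K * real (?i t - ?i s) + real L"
      by (metis of_nat_add of_nat_le_iff of_nat_mult)+
    have diff: "real (?i t - ?i s) \<le> \<bar>s - t\<bar> + 1" "\<bar>s - t\<bar> \<le> real (?i t - ?i s) + 1"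
      using index(2,3)[OF that(1)] index(2,3)[OF that(2)] that(3)
      unfolding of_nat_diff[OF ij(1)] by linarith+
    have "real ?D \<le> real K * (\<bar>s - t\<bar> + 1) + real L"
      using D(2) mult_left_mono[OF diff(1), of "real K"] by linarith
    moreover have "\<bar>s - t\<bar> \<le> real K * (real ?D + real (K + L))"
    proof -
      have "1 \<le> real K * real K" "real L \<le> real K * real L"
        using K by (auto simp: mult_le_cancel_right1 intro: mult_ge1_I)
      then have "real K * real ?D + real L + 1 \<le> real K * (real ?D + real (K + L))"
        by (simp add: algebra_simps)
      then show ?thesis using D(1) diff(2) by linarith
    qed
    ultimately show ?thesis using K by (simp add: field_simps)
  qed
  fix s t assume st: "s \<in> {0..real n}" "t \<in> {0..real n}"
  let ?D = "graph_dist \<Gamma> (x (?i s)) (x (?i t))"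
  have eq: "realization_dist \<Gamma> (indicator {x (?i s)}) (indicator {x (?i t)}) = real ?D"
    by (rule realization_dist_vertices[OF edges metric]) (use index in_verts st in auto)
  have "1 / real K * \<bar>s - t\<bar> - real (K + L) \<le> real ?D \<and> real ?D \<le> real K * \<bar>s - t\<bar> + real (K + L)"
  proof (cases "s \<le> t")
    case True
    then show ?thesis using bounds st by blast
  next
    case False
    then show ?thesis
      using bounds[OF st(2,1)] d_sym[of "x (?i s)" "x (?i t)"] index in_verts st
      by (simp add: abs_minus_commute)
  qed
  then show "1 / real K * \<bar>s - t\<bar> - real (K + L)
      \<le> realization_dist \<Gamma> (indicator {x (?i s)}) (indicator {x (?i t)})"
    "realization_dist \<Gamma> (indicator {x (?i s)}) (indicator {x (?i t)})
      \<le> real K * \<bar>s - t\<bar> + real (K + L)"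
    unfolding eq by blast+
qed

lemma strongly_quasiconvex_subset_imp_morse_set:
  assumes edges: "\<And>e. e \<in> edges \<Gamma> \<Longrightarrow> \<exists>a b. a \<noteq> b \<and> e = {a, b}"
    and metric: "geodesic_graph_metric (verts \<Gamma>) (graph_dist \<Gamma>)"
    and Y: "Y \<subseteq> verts \<Gamma>" "Y \<noteq> {}"
    and qc: "strongly_quasiconvex_subset (realization \<Gamma>) (realization_dist \<Gamma>)
      ((\<lambda>v. indicator {v}) ` Y)"
  shows "\<exists>\<mu>. geodesic_graph_metric.morse_set (verts \<Gamma>) (graph_dist \<Gamma>) \<mu> Y"
proof -
  interpret geodesic_graph_metric "verts \<Gamma>" "graph_dist \<Gamma>" by (rule metric)
  have "\<exists>M. \<forall>n x. discrete_quasi_geodesic K L n x \<and> x 0 \<in> Y \<and> x n \<in> Y \<longrightarrow>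
      (\<forall>i\<le>n. dist_to Y (x i) \<le> M)" if K: "K \<ge> 1" for K L
  proof -
    have "1 \<le> real K" "0 \<le> real (K + L)" using K by auto
    then obtain M where M: "\<And>a b c. a \<le> b \<and>
        quasi_geodesic (realization \<Gamma>) (realization_dist \<Gamma>) (real K) (real (K + L)) {a..b} c \<and>
        c a \<in> (\<lambda>v. indicator {v}) ` Y \<and> c b \<in> (\<lambda>v. indicator {v}) ` Y \<Longrightarrow>
        c ` {a..b} \<subseteq> metric_neighborhood (realization \<Gamma>) (realization_dist \<Gamma>) M
          ((\<lambda>v. indicator {v}) ` Y)"
      using qc unfolding strongly_quasiconvex_subset_def by meson
    have "dist_to Y (x i) \<le> nat \<lfloor>M\<rfloor>"
      if x: "discrete_quasi_geodesic K L n x" "x 0 \<in> Y" "x n \<in> Y" and i: "i \<le> n" for n x i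
    proof -
      let ?c = "\<lambda>t. indicator {x (nat \<lfloor>t\<rfloor>)} :: _ \<Rightarrow> real"
      have "?c ` {0..real n} \<subseteq> metric_neighborhood (realization \<Gamma>) (realization_dist \<Gamma>) M
          ((\<lambda>v. indicator {v}) ` Y)"
        using discrete_quasi_geodesic_extends[OF edges metric K x(1)] x(2,3) by (intro M) auto
      moreover have "?c (real i) \<in> ?c ` {0..real n}" using i by (intro imageI) auto
      ultimately obtain y where y: "y \<in> Y"
          "realization_dist \<Gamma> (indicator {x i}) (indicator {y}) \<le> M"
        unfolding metric_neighborhood_def by auto
      have "x i \<in> verts \<Gamma>" using x(1) i by (simp add: discrete_quasi_geodesic_def)
      then have "real (graph_dist \<Gamma> (x i) y) \<le> M"
        using y realization_dist_vertices[OF edges metric, of "x i" y] Y by auto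
      then have "graph_dist \<Gamma> (x i) y \<le> nat \<lfloor>M\<rfloor>" by (simp add: le_nat_floor)
      then show ?thesis using dist_to_le[OF y(1), of "x i"] by linarith
    qed
    then show ?thesis by blast
  qed
  then obtain \<mu> where "\<And>K L n x i. K \<ge> 1 \<Longrightarrow> discrete_quasi_geodesic K L n x \<Longrightarrow> x 0 \<in> Y \<Longrightarrow> x n \<in> Y
      \<Longrightarrow> i \<le> n \<Longrightarrow> dist_to Y (x i) \<le> \<mu> K L"
    by metis
  then have "morse_set \<mu> Y" using Y unfolding morse_set_def by blast
  then show ?thesis by blast
qed


section \<open>Cosets of a Morse subgroup are boundedly packed\<close>

lemma adjacency_cayley_graph:
  fixes G (structure)
  assumes "group G" "S \<subseteq> carrier G"
  shows "(u, v) \<in> adjacency (cayley_graph G S) \<longleftrightarrow>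
    u \<in> carrier G \<and> v \<in> carrier G \<and> u \<noteq> v \<and> (\<exists>s\<in>S. v = u \<otimes> s \<or> u = v \<otimes> s)"
proof -
  interpret group G by fact
  have "{u, v} \<in> edges (cayley_graph G S) \<longleftrightarrow> (\<exists>g s. {u, v} = {g, g \<otimes> s} \<and> g \<in> carrier G \<and> s \<in> S \<and> s \<noteq> \<one>)"
    by (auto simp: cayley_graph_def)
  also have "\<dots> \<longleftrightarrow> u \<in> carrier G \<and> v \<in> carrier G \<and> (\<exists>s\<in>S. s \<noteq> \<one> \<and> (v = u \<otimes> s \<or> u = v \<otimes> s))"
    using assms(2) by (auto simp: doubleton_eq_iff)
  finally have edge: "{u, v} \<in> edges (cayley_graph G S) \<longleftrightarrow>
    u \<in> carrier G \<and> v \<in> carrier G \<and> (\<exists>s\<in>S. s \<noteq> \<one> \<and> (v = u \<otimes> s \<or> u = v \<otimes> s))" .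
  have "u \<noteq> v \<Longrightarrow> u \<in> carrier G \<Longrightarrow> v \<in> carrier G \<Longrightarrow> v = u \<otimes> s \<or> u = v \<otimes> s \<Longrightarrow> s \<noteq> \<one>" for s
    by auto
  then show ?thesis unfolding adjacency_def using edge by blast
qed

locale marked_group = group G for G (structure) +
  fixes S
  assumes generating: "finite_generating_set G S"
begin

abbreviation wdist where "wdist \<equiv> graph_dist (cayley_graph G S)"

lemma S_carrier: "S \<subseteq> carrier G" and S_finite: "finite S" and S_generates: "generate G S = carrier G"
  using generating by (auto simp: finite_generating_set_def)

lemmas adjacency_iff = adjacency_cayley_graph[OF is_group S_carrier]

lemma cayley_graph_step:
  assumes "u \<in> carrier G" "s \<in> S"
  shows "(u, u \<otimes> s) \<in> (adjacency (cayley_graph G S))\<^sup>*"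
    and "(u, u \<otimes> inv s) \<in> (adjacency (cayley_graph G S))\<^sup>*"
proof -
  have s: "s \<in> carrier G" using assms S_carrier by blast
  show "(u, u \<otimes> s) \<in> (adjacency (cayley_graph G S))\<^sup>*"
  proof (cases "u = u \<otimes> s")
    case False
    then have "(u, u \<otimes> s) \<in> adjacency (cayley_graph G S)"
      using assms s by (auto simp: adjacency_iff)
    then show ?thesis by blast
  qed (metis rtrancl.rtrancl_refl)
  have "u = (u \<otimes> inv s) \<otimes> s" using assms s by (simp add: m_assoc)
  show "(u, u \<otimes> inv s) \<in> (adjacency (cayley_graph G S))\<^sup>*"
  proof (cases "u = u \<otimes> inv s")
    case False
    then have "(u, u \<otimes> inv s) \<in> adjacency (cayley_graph G S)"
      using assms s \<open>u = (u \<otimes> inv s) \<otimes> s\<close> unfolding adjacency_iff by blast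
    then show ?thesis by blast
  qed (metis rtrancl.rtrancl_refl)
qed

lemma cayley_graph_connected:
  assumes "u \<in> carrier G" "v \<in> carrier G"
  shows "(u, v) \<in> (adjacency (cayley_graph G S))\<^sup>*"
proof -
  have reach: "(x, x \<otimes> h) \<in> (adjacency (cayley_graph G S))\<^sup>*"
    if "h \<in> generate G S" "x \<in> carrier G" for h x
    using that
  proof (induction h arbitrary: x rule: generate.induct)
    case (eng h1 h2)
    then have "h1 \<in> carrier G" "h2 \<in> carrier G" using S_generates by auto
    then show ?case using eng(3)[of x] eng(4)[of "x \<otimes> h1"] eng(5) by (simp add: m_assoc)
  qed (simp_all add: cayley_graph_step)
  have "v = u \<otimes> (inv u \<otimes> v)" using assms by (simp add: m_assoc[symmetric])
  then show ?thesis using reach[of "inv u \<otimes> v" u] assms S_generates by simp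
qed

sublocale geodesic_graph_metric "carrier G" wdist
  by (rule graph_dist_geodesic) (auto simp: adjacency_iff cayley_graph_connected)

lemma wdist_translate_le:
  assumes "g \<in> carrier G" "u \<in> carrier G" "v \<in> carrier G"
  shows "wdist (g \<otimes> u) (g \<otimes> v) \<le> wdist u v"
proof (rule graph_dist_le)
  have "(g \<otimes> u, g \<otimes> v) \<in> adjacency (cayley_graph G S) ^^ n"
    if "(u, v) \<in> adjacency (cayley_graph G S) ^^ n" for n
    using that
  proof (induction n arbitrary: v)
    case (Suc n)
    then obtain w where w: "(u, w) \<in> adjacency (cayley_graph G S) ^^ n"
        "(w, v) \<in> adjacency (cayley_graph G S)" by auto
    have "(g \<otimes> w, g \<otimes> v) \<in> adjacency (cayley_graph G S)"
      using w(2) assms(1) S_carrier unfolding adjacency_iff by (auto simp: m_assoc subset_iff)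
    then show ?case using Suc(1)[OF w(1)] by auto
  qed simp
  then show "(g \<otimes> u, g \<otimes> v) \<in> adjacency (cayley_graph G S) ^^ wdist u v"
    using graph_dist_walk[OF cayley_graph_connected] assms by blast
qed

lemma wdist_translate:
  assumes "g \<in> carrier G" "u \<in> carrier G" "v \<in> carrier G"
  shows "wdist (g \<otimes> u) (g \<otimes> v) = wdist u v"
  using wdist_translate_le[OF assms] wdist_translate_le[of "inv g" "g \<otimes> u" "g \<otimes> v"] assms
  by (simp add: m_assoc[symmetric])

lemma finite_ball: "finite {v \<in> carrier G. wdist \<one> v \<le> n}"
proof (induction n)
  case 0
  have "{v \<in> carrier G. wdist \<one> v \<le> 0} \<subseteq> {\<one>}" using d_eq_0[of \<one>] by auto
  then show ?case by (rule finite_subset) simp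
next
  case (Suc n)
  let ?B = "{v \<in> carrier G. wdist \<one> v \<le> n}"
  have "{v \<in> carrier G. wdist \<one> v \<le> Suc n} \<subseteq> ?B \<union> (\<Union>u\<in>?B. \<Union>s\<in>S. {u \<otimes> s, u \<otimes> inv s})"
  proof
    fix v assume v: "v \<in> {v \<in> carrier G. wdist \<one> v \<le> Suc n}"
    show "v \<in> ?B \<union> (\<Union>u\<in>?B. \<Union>s\<in>S. {u \<otimes> s, u \<otimes> inv s})"
    proof (cases "wdist \<one> v \<le> n")
      case False
      then have "wdist \<one> v = n + 1" using v by simp
      then obtain u where u: "u \<in> carrier G" "wdist \<one> u = n" "wdist u v = 1"
        using d_interpolate[of \<one> v n 1] v by auto
      have "(u, v) \<in> adjacency (cayley_graph G S) ^^ 1"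
        using graph_dist_walk[OF cayley_graph_connected, of u v] u v by simp
      then obtain s where s: "s \<in> S" "v = u \<otimes> s \<or> u = v \<otimes> s" by (auto simp: adjacency_iff)
      then have "v = u \<otimes> s \<or> v = u \<otimes> inv s"
        using v S_carrier by (auto simp: m_assoc subset_iff)
      then show ?thesis using u s by blast
    qed (use v in simp)
  qed
  moreover have "finite (?B \<union> (\<Union>u\<in>?B. \<Union>s\<in>S. {u \<otimes> s, u \<otimes> inv s}))"
    using Suc S_finite by simp
  ultimately show ?case by (rule finite_subset)
qed

lemma l_coset_image: "g <# Y = (\<lambda>y. g \<otimes> y) ` Y"
  by (auto simp: l_coset_def)

lemma dist_to_translate:
  assumes "g \<in> carrier G" "Y \<subseteq> carrier G" "u \<in> carrier G"
  shows "dist_to (g <# Y) (g \<otimes> u) = dist_to Y u"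
proof -
  have "(\<lambda>y. wdist (g \<otimes> u) (g \<otimes> y)) ` Y = wdist u ` Y"
    using assms wdist_translate by (intro image_cong) auto
  then show ?thesis unfolding dist_to_def l_coset_image image_image by simp
qed

lemma l_coset_mem_iff:
  assumes "g \<in> carrier G" "Y \<subseteq> carrier G" "u \<in> carrier G"
  shows "u \<in> g <# Y \<longleftrightarrow> inv g \<otimes> u \<in> Y"
proof
  assume "u \<in> g <# Y"
  then show "inv g \<otimes> u \<in> Y"
    using assms by (auto simp: l_coset_image m_assoc[symmetric] subset_iff)
next
  assume "inv g \<otimes> u \<in> Y"
  moreover have "u = g \<otimes> (inv g \<otimes> u)" using assms by (simp add: m_assoc[symmetric])
  ultimately show "u \<in> g <# Y" unfolding l_coset_image by blast
qed

lemma dist_to_coset: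
  assumes "g \<in> carrier G" "Y \<subseteq> carrier G" "u \<in> carrier G"
  shows "dist_to (g <# Y) u = dist_to Y (inv g \<otimes> u)"
  using dist_to_translate[of g Y "inv g \<otimes> u"] assms by (simp add: m_assoc[symmetric])

lemma morse_set_translate:
  assumes M: "morse_set \<mu> Y" and g: "g \<in> carrier G"
  shows "morse_set \<mu> (g <# Y)"
proof -
  have Y: "Y \<subseteq> carrier G" "Y \<noteq> {}" using M by (auto simp: morse_set_def)
  have "dist_to (g <# Y) (x i) \<le> \<mu> K L"
    if K: "K \<ge> 1" and x: "discrete_quasi_geodesic K L n x" "x 0 \<in> g <# Y" "x n \<in> g <# Y" "i \<le> n"
    for K L n x i
  proof -
    have in_G: "x i \<in> carrier G" if "i \<le> n" for i
      using x that by (simp add: discrete_quasi_geodesic_def)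
    have "discrete_quasi_geodesic K L n (\<lambda>i. inv g \<otimes> x i)"
      using x(1) g unfolding discrete_quasi_geodesic_def by (simp add: wdist_translate)
    moreover have "inv g \<otimes> x 0 \<in> Y" "inv g \<otimes> x n \<in> Y"
      using x in_G l_coset_mem_iff[OF g Y(1)] by auto
    ultimately have "dist_to Y (inv g \<otimes> x i) \<le> \<mu> K L"
      using morse_setD[OF M K, of L n "\<lambda>i. inv g \<otimes> x i"] x(4) by simp
    then show ?thesis using dist_to_coset g Y in_G x(4) by simp
  qed
  then show ?thesis
    using Y l_coset_subset_G[OF Y(1) g] unfolding morse_set_def l_coset_image by blast
qed

lemma coboundary_within_translate:
  assumes "coboundary_within r Y B" and g: "g \<in> carrier G" and sub: "Y \<subseteq> carrier G" "B \<subseteq> carrier G"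
  shows "coboundary_within r (g <# Y) (g <# B)"
  unfolding coboundary_within_def
proof (intro ballI impI)
  fix u v assume uv: "u \<in> carrier G" "v \<in> carrier G" "wdist u v = 1" "u \<in> g <# B" "v \<notin> g <# B"
  have "wdist (inv g \<otimes> u) (inv g \<otimes> v) = 1" using wdist_translate g uv by simp
  moreover have "inv g \<otimes> u \<in> B" "inv g \<otimes> v \<notin> B" using uv l_coset_mem_iff[OF g sub(2)] by auto
  ultimately have "dist_to Y (inv g \<otimes> u) \<le> r \<and> dist_to Y (inv g \<otimes> v) \<le> r"
    using assms(1) g uv unfolding coboundary_within_def by (meson inv_closed m_closed)
  then show "dist_to (g <# Y) u \<le> r \<and> dist_to (g <# Y) v \<le> r"
    using dist_to_coset[OF g sub(1)] uv by simp
qed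

text \<open>
  Left multiplication by an element of \<open>H\<close> is an isometry that preserves \<open>H\<close>, so the distance to
  \<open>H\<close> is a function on the quotient by \<open>H\<close>.
\<close>

lemma dist_to_subgroup_r_coset:
  assumes H: "subgroup H G" and "u \<in> carrier G" "v \<in> carrier G" "H #> u = H #> v"
  shows "dist_to H u = dist_to H v"
proof -
  have "u \<in> H #> v" using rcos_self[OF assms(2) H] assms(4) by simp
  then obtain h where h: "h \<in> H" "u = h \<otimes> v" unfolding r_coset_def by blast
  have "h \<in> carrier G" using subgroup.mem_carrier[OF H h(1)] .
  then show ?thesis
    using dist_to_translate[of h H v] coset_join3[OF _ H h(1)] subgroup.subset[OF H] assms h by simp
qed

lemma finite_left_quotient_bounded:
  assumes H: "subgroup H G" and B: "B \<subseteq> carrier G" and fin: "finite (left_quotient G H B)"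
  shows "\<exists>r. \<forall>v\<in>B. dist_to H v \<le> r"
proof -
  let ?r = "\<lambda>c. dist_to H (inv_into B (\<lambda>x. H #> x) c)"
  have "dist_to H v \<in> ?r ` left_quotient G H B" if "v \<in> B" for v
  proof -
    let ?v = "inv_into B (\<lambda>x. H #> x) (H #> v)"
    have "H #> v \<in> (\<lambda>x. H #> x) ` B" using that by (rule imageI)
    then have "H #> ?v = H #> v" "?v \<in> B" by (rule f_inv_into_f, rule inv_into_into)
    then have "dist_to H v = dist_to H ?v"
      using that B by (intro dist_to_subgroup_r_coset[OF H]) auto
    then show ?thesis using that unfolding left_quotient_def by blast
  qed
  then have "\<forall>v\<in>B. dist_to H v \<le> Max (?r ` left_quotient G H B)" using fin by simp
  then show ?thesis by blast
qed

text \<open>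
  An edge that leaves \<open>A\<close> joins some \<open>u\<close> to \<open>u \<otimes> t\<close>, where \<open>t\<close> is a generator or the inverse of one,
  and its end lies in the symmetric difference of \<open>A\<close> and \<open>A #> t\<close>, which consists of finitely many
  cosets of \<open>H\<close>. There are finitely many \<open>t\<close>.
\<close>

lemma almost_invariant_coboundary:
  assumes H: "subgroup H G" and A: "almost_invariant G H A"
  shows "\<exists>r. coboundary_within r H A"
proof -
  have AG: "A \<subseteq> carrier G" using A by (simp add: almost_invariant_def)
  have "\<exists>r. \<forall>v\<in>sym_diff A (A #> t). dist_to H v \<le> r" if "t \<in> carrier G" for t
    using A that r_coset_subset_G[OF AG that] AG
    by (intro finite_left_quotient_bounded[OF H]) (auto simp: almost_invariant_def)
  then obtain \<rho> where \<rho>: "\<And>t v. t \<in> carrier G \<Longrightarrow> v \<in> sym_diff A (A #> t) \<Longrightarrow> dist_to H v \<le> \<rho> t"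
    by metis
  define T where "T = S \<union> (\<lambda>s. inv s) ` S"
  define r where "r = Max (\<rho> ` T)"
  have T: "finite T" "T \<subseteq> carrier G" using S_finite S_carrier by (auto simp: T_def)
  have "dist_to H u \<le> r + 1 \<and> dist_to H v \<le> r + 1"
    if uv: "u \<in> carrier G" "v \<in> carrier G" "wdist u v = 1" "u \<in> A" "v \<notin> A" for u v
  proof -
    have "(u, v) \<in> adjacency (cayley_graph G S) ^^ 1"
      using graph_dist_walk[OF cayley_graph_connected, of u v] uv by simp
    then obtain s where s: "s \<in> S" "v = u \<otimes> s \<or> u = v \<otimes> s" by (auto simp: adjacency_iff)
    then have "v = u \<otimes> s \<or> v = u \<otimes> inv s" using uv S_carrier by (auto simp: m_assoc subset_iff)
    then obtain t where t: "t \<in> T" "v = u \<otimes> t" using s by (auto simp: T_def)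
    then have "v \<in> sym_diff A (A #> t)" using uv unfolding r_coset_def by blast
    then have "dist_to H v \<le> \<rho> t" using \<rho> t T by blast
    also have "\<rho> t \<le> r" unfolding r_def using t T by simp
    finally have "dist_to H v \<le> r" .
    moreover have "dist_to H u \<le> wdist u v + dist_to H v"
      using subgroup.subset[OF H] subgroup.one_closed[OF H] uv by (intro dist_to_lipschitz) auto
    ultimately show ?thesis using uv(3) by simp
  qed
  then show ?thesis unfolding coboundary_within_def by blast
qed

text \<open>
  By the coarse Helly property, some ball of radius \<open>helly_radius \<mu> D\<close> meets all the cosets. They
  are pairwise disjoint, so there are at most as many as elements of the ball.
\<close>

theorem bounded_packing:
  assumes H: "subgroup H G" and M: "morse_set \<mu> H"
    and I: "finite I" "I \<subseteq> carrier G" "inj_on (\<lambda>g. g <# H) I"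
    and close: "\<And>g g'. \<lbrakk>g \<in> I; g' \<in> I\<rbrakk> \<Longrightarrow> \<exists>y\<in>g <# H. dist_to (g' <# H) y \<le> D"
  shows "card I \<le> card {v \<in> carrier G. wdist \<one> v \<le> helly_radius \<mu> D}"
proof (cases "I = {}")
  case False
  let ?B = "{v \<in> carrier G. wdist \<one> v \<le> helly_radius \<mu> D}"
  have HG: "H \<subseteq> carrier G" using subgroup.subset[OF H] .
  have "\<exists>z\<in>carrier G. \<forall>Y\<in>(\<lambda>g. g <# H) ` I. dist_to Y z \<le> helly_radius \<mu> D"
    using I False close morse_set_translate[OF M]
    by (intro morse_sets_coarse_helly) (auto simp: subset_iff)
  then obtain z where z: "z \<in> carrier G" "\<And>g. g \<in> I \<Longrightarrow> dist_to (g <# H) z \<le> helly_radius \<mu> D"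
    by blast
  have "g <# H \<in> (\<lambda>b. (z \<otimes> b) <# H) ` ?B" if g: "g \<in> I" for g
  proof -
    have gG: "g \<in> carrier G" using g I by blast
    have "g <# H \<noteq> {}" using subgroup.one_closed[OF H] by (auto simp: l_coset_image)
    then obtain y where y: "y \<in> g <# H" "wdist z y \<le> helly_radius \<mu> D"
      using nearest_point_exists z(2)[OF g] by metis
    have yG: "y \<in> carrier G" using y l_coset_subset_G[OF HG gG] by blast
    have zy: "z \<otimes> (inv z \<otimes> y) = y" using z yG by (simp add: m_assoc[symmetric])
    have "wdist \<one> (inv z \<otimes> y) = wdist z y"
      using wdist_translate[of z \<one> "inv z \<otimes> y"] z yG zy by simp
    then have "inv z \<otimes> y \<in> ?B" using y z yG by simp
    moreover have "g <# H = (z \<otimes> (inv z \<otimes> y)) <# H"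
      unfolding zy by (rule l_repr_independence[OF y(1) gG H])
    ultimately show ?thesis by blast
  qed
  then have "(\<lambda>g. g <# H) ` I \<subseteq> (\<lambda>b. (z \<otimes> b) <# H) ` ?B" by blast
  then have "card ((\<lambda>g. g <# H) ` I) \<le> card ?B" using finite_ball by (rule surj_card_le[rotated])
  then show ?thesis using I by (simp add: card_image)
qed simp

end


section \<open>Cubes of Sageev's complex are families of crossing translates\<close>

definition crossing :: "'a set \<Rightarrow> 'a set \<Rightarrow> 'a set \<Rightarrow> bool" where
  "crossing X B C \<longleftrightarrow> B \<inter> C \<noteq> {} \<and> B - C \<noteq> {} \<and> C - B \<noteq> {} \<and> X - B - C \<noteq> {}"

lemma crossing_compl_left: "B \<subseteq> X \<Longrightarrow> C \<subseteq> X \<Longrightarrow> crossing X (X - B) C \<longleftrightarrow> crossing X B C"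
  unfolding crossing_def by (auto simp: Diff_Diff_Int double_diff)

lemma crossing_commute: "crossing X B C \<longleftrightarrow> crossing X C B"
  unfolding crossing_def by blast

context
  fixes G :: "('a, 'm) monoid_scheme" (structure) and A :: "'a set"
  assumes group: "group G" and A: "A \<subseteq> carrier G"
begin

interpretation group G by (rule group)

abbreviation "halfspaces \<equiv> sageev_halfspaces G A"
abbreviation "ultrafilter \<equiv> sageev_ultrafilter G A"

lemma l_coset_compl:
  assumes g: "g \<in> carrier G"
  shows "(g <# (carrier G - A)) = carrier G - (g <# A)"
proof -
  have "inj_on (\<lambda>y. g \<otimes> y) (carrier G)" using g by (simp add: inj_on_def)
  moreover have "(\<lambda>y. g \<otimes> y) ` carrier G = carrier G" using g by (rule surj_const_mult)
  moreover have "g <# Y = (\<lambda>y. g \<otimes> y) ` Y" for Y by (auto simp: l_coset_def)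
  ultimately show ?thesis using A by (metis inj_on_image_set_diff Diff_subset order_refl)
qed

lemma halfspace_cases:
  assumes "B \<in> halfspaces"
  shows "\<exists>g\<in>carrier G. B = g <# A \<or> B = carrier G - (g <# A)"
  using assms l_coset_compl unfolding sageev_halfspaces_def by blast

lemma halfspace_subset: "B \<in> halfspaces \<Longrightarrow> B \<subseteq> carrier G"
  using halfspace_cases l_coset_subset_G[OF A] by blast

lemma halfspace_compl:
  assumes "B \<in> halfspaces" shows "carrier G - B \<in> halfspaces"
proof -
  obtain g where g: "g \<in> carrier G" "B = g <# A \<or> B = carrier G - (g <# A)"
    using halfspace_cases assms by blast
  have "carrier G - (carrier G - (g <# A)) = g <# A"
    using l_coset_subset_G[OF A g(1)] by (simp add: double_diff)
  then show ?thesis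
    using g(2) l_coset_compl[OF g(1)] g(1) unfolding sageev_halfspaces_def by blast
qed

text \<open>
  If \<open>B\<close> and \<open>C\<close> were disjoint, \<open>B\<close> would be contained in the complement of \<open>C\<close>, which would then
  also belong to the ultrafilter.
\<close>

lemma ultrafilter_meet:
  assumes U: "ultrafilter U" and "B \<in> U" "C \<in> U" shows "B \<inter> C \<noteq> {}"
proof
  assume "B \<inter> C = {}"
  have HS: "B \<in> halfspaces" "C \<in> halfspaces" using U assms by (auto simp: sageev_ultrafilter_def)
  then have "B \<subseteq> carrier G - C" using \<open>B \<inter> C = {}\<close> halfspace_subset by blast
  then have "carrier G - C \<in> U"
    using U \<open>B \<in> U\<close> halfspace_compl[OF HS(2)] unfolding sageev_ultrafilter_def by blast
  then show False using U \<open>C \<in> U\<close> HS unfolding sageev_ultrafilter_def by blast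
qed

lemma sageev_edge:
  assumes "{U, V} \<in> edges (sageev_graph G A)"
  shows "ultrafilter U \<and> ultrafilter V \<and> (\<exists>B\<in>halfspaces. B \<in> U \<and> carrier G - B \<in> V \<and> sym_diff U V = {B, carrier G - B})"
proof -
  obtain U' V' B where e: "{U, V} = {U', V'}" "ultrafilter U'" "ultrafilter V'" "B \<in> halfspaces"
      "sym_diff U' V' = {B, carrier G - B}"
    using assms unfolding sageev_graph_def by auto
  then have UV: "ultrafilter U" "ultrafilter V" "sym_diff U V = {B, carrier G - B}"
    by (auto simp: doubleton_eq_iff)
  have B: "(B \<in> U) \<noteq> (carrier G - B \<in> U)" "(B \<in> V) \<noteq> (carrier G - B \<in> V)"
    using UV e(4) unfolding sageev_ultrafilter_def by blast+
  have dd: "carrier G - (carrier G - B) = B" using halfspace_subset[OF e(4)] by (simp add: double_diff)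
  show ?thesis
  proof (cases "B \<in> U")
    case True
    then have "carrier G - B \<in> V" using B UV(3) by blast
    then show ?thesis using UV e(4) True by blast
  next
    case False
    then have "carrier G - B \<in> U" "B \<in> V" using B UV(3) by blast+
    then have "carrier G - B \<in> halfspaces \<and> carrier G - B \<in> U \<and> carrier G - (carrier G - B) \<in> V \<and>
        sym_diff U V = {carrier G - B, carrier G - (carrier G - B)}"
      using UV(3) halfspace_compl[OF e(4)] unfolding dd by blast
    then show ?thesis using UV(1,2) by blast
  qed
qed

text \<open>
  Around a square, opposite edges flip the same pair of halfspaces: \<open>V\<close> and \<open>V'\<close> arise from \<open>U\<close> by
  flipping \<open>B\<close> and \<open>C\<close>, respectively, and \<open>W\<close> by flipping both. So each corner, an intersection of
  \<open>B\<close> or its complement with \<open>C\<close> or its complement, is the intersection of two members of one of the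
  four ultrafilters, and is nonempty.
\<close>

lemma sageev_square_crossing:
  assumes edges: "{U, V} \<in> edges (sageev_graph G A)" "{U, V'} \<in> edges (sageev_graph G A)"
      "{V, W} \<in> edges (sageev_graph G A)" "{V', W} \<in> edges (sageev_graph G A)"
    and distinct: "V \<noteq> V'" "U \<noteq> W"
    and B: "B \<in> U" "sym_diff U V = {B, carrier G - B}"
    and C: "C \<in> U" "sym_diff U V' = {C, carrier G - C}"
  shows "crossing (carrier G) B C"
proof -
  have UF: "ultrafilter U" "ultrafilter V" "ultrafilter V'" "ultrafilter W" using sageev_edge edges by blast+
  have HS: "B \<in> halfspaces" "C \<in> halfspaces" using UF(1) B C unfolding sageev_ultrafilter_def by blast+
  obtain E where E: "E \<in> halfspaces" "sym_diff V W = {E, carrier G - E}"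
    using sageev_edge[OF edges(3)] by blast
  obtain F where F: "F \<in> halfspaces" "sym_diff V' W = {F, carrier G - F}"
    using sageev_edge[OF edges(4)] by blast
  have sub: "B \<subseteq> carrier G" "C \<subseteq> carrier G" "E \<subseteq> carrier G" "F \<subseteq> carrier G"
    by (intro halfspace_subset HS E(1) F(1))+
  have compl_U: "carrier G - B \<notin> U" "carrier G - C \<notin> U"
    using UF(1) HS B(1) C(1) unfolding sageev_ultrafilter_def by blast+
  have flip: "x \<in> Q \<longleftrightarrow> (x \<in> P) \<noteq> (x \<in> D)" if "sym_diff P Q = D" for x :: "'a set" and P Q D
    using that by blast
  have "B \<noteq> C"
  proof
    assume "B = C"
    then have "x \<in> V \<longleftrightarrow> x \<in> V'" for x using flip[OF B(2), of x] flip[OF C(2), of x] by simp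
    then show False using distinct(1) by blast
  qed
  then have ne: "B \<noteq> C" "B \<noteq> carrier G - C" "C \<noteq> carrier G - B"
      "carrier G - B \<noteq> carrier G - C" using B(1) C(1) compl_U sub by auto
  have V: "B \<notin> V" "carrier G - B \<in> V" "C \<in> V"
    using B(1) C(1) compl_U ne by (simp_all add: flip[OF B(2)])
  have V': "C \<notin> V'" "carrier G - C \<in> V'" "B \<in> V'"
    using B(1) C(1) compl_U ne by (simp_all add: flip[OF C(2)])
  \<comment> \<open>Flipping \<open>B\<close> a second time would lead from \<open>V\<close> back to \<open>U\<close>; likewise for \<open>C\<close> below.\<close>
  have "B \<notin> {E, carrier G - E}"
  proof
    assume "B \<in> {E, carrier G - E}"
    then have "{E, carrier G - E} = {B, carrier G - B}" using sub by (auto simp: double_diff)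
    then have "x \<in> W \<longleftrightarrow> x \<in> U" for x using flip[OF B(2), of x] flip[OF E(2), of x] by auto
    then show False using distinct(2) by blast
  qed
  then have W1: "B \<notin> W" using V by (simp add: flip[OF E(2)])
  have "C \<notin> {F, carrier G - F}"
  proof
    assume "C \<in> {F, carrier G - F}"
    then have "{F, carrier G - F} = {C, carrier G - C}" using sub by (auto simp: double_diff)
    then have "x \<in> W \<longleftrightarrow> x \<in> U" for x using flip[OF C(2), of x] flip[OF F(2), of x] by auto
    then show False using distinct(2) by blast
  qed
  then have W2: "C \<notin> W" using V' by (simp add: flip[OF F(2)])
  have W: "carrier G - B \<in> W" "carrier G - C \<in> W"
    using W1 W2 UF(4) HS unfolding sageev_ultrafilter_def by blast+
  have "B \<inter> C \<noteq> {}" using ultrafilter_meet[OF UF(1)] B C by blast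
  moreover have "B \<inter> (carrier G - C) \<noteq> {}" using ultrafilter_meet[OF UF(3)] V' by blast
  moreover have "(carrier G - B) \<inter> C \<noteq> {}" using ultrafilter_meet[OF UF(2)] V by blast
  moreover have "(carrier G - B) \<inter> (carrier G - C) \<noteq> {}" using ultrafilter_meet[OF UF(4)] W by blast
  ultimately show ?thesis unfolding crossing_def by blast
qed

text \<open>
  The directions of a cube correspond to the edges at its vertex \<open>f {}\<close>, and any two of these edges
  span a square of the cube.
\<close>

lemma sageev_cube_crossing:
  assumes Q: "subgraph Q X" "edges X \<subseteq> edges (sageev_graph G A)"
    and iso: "graph_isomorphic (cube_skeleton n) Q"
  shows "\<exists>g. \<forall>i<n. g i \<in> carrier G \<and>
    (\<forall>j<n. i \<noteq> j \<longrightarrow> crossing (carrier G) (g i <# A) (g j <# A))"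
proof -
  obtain f where f: "bij_betw f (Pow {..<n}) (verts Q)"
      "edges Q = (\<lambda>e. f ` e) ` edges (cube_skeleton n)"
    using iso by (auto simp: graph_isomorphic_def cube_skeleton_def)
  have inj: "f P \<noteq> f P'" if "P \<subseteq> {..<n}" "P' \<subseteq> {..<n}" "P \<noteq> P'" for P P'
    using f(1) that unfolding bij_betw_def inj_on_def by blast
  have edge: "{f P, f (insert i P)} \<in> edges (sageev_graph G A)"
    if "P \<subseteq> {..<n}" "i < n" "i \<notin> P" for P i
  proof -
    have "{P, insert i P} \<in> edges (cube_skeleton n)" using that by (auto simp: cube_skeleton_def)
    then have "f ` {P, insert i P} \<in> edges Q" unfolding f(2) by (rule imageI)
    then show ?thesis using Q by (auto simp: subgraph_def)
  qed
  have "\<exists>B g. B \<in> f {} \<and> sym_diff (f {}) (f {i}) = {B, carrier G - B} \<and> g \<in> carrier G \<and>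
      (B = g <# A \<or> B = carrier G - (g <# A))" if "i < n" for i
    using sageev_edge[OF edge[of "{}" i]] halfspace_cases that by (metis empty_iff empty_subsetI)
  then obtain B g where Bg: "\<And>i. i < n \<Longrightarrow> B i \<in> f {} \<and>
      sym_diff (f {}) (f {i}) = {B i, carrier G - B i} \<and> g i \<in> carrier G \<and>
      (B i = g i <# A \<or> B i = carrier G - (g i <# A))" by metis
  have "crossing (carrier G) (g i <# A) (g j <# A)" if ij: "i < n" "j < n" "i \<noteq> j" for i j
  proof -
    have "crossing (carrier G) (B i) (B j)"
    proof (rule sageev_square_crossing)
      show "{f {}, f {i}} \<in> edges (sageev_graph G A)" "{f {}, f {j}} \<in> edges (sageev_graph G A)"
        using edge[of "{}"] ij by auto
      show "{f {i}, f {i, j}} \<in> edges (sageev_graph G A)"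
        using edge[of "{i}" j] ij by (simp add: insert_commute)
      show "{f {j}, f {i, j}} \<in> edges (sageev_graph G A)"
        using edge[of "{j}" i] ij by simp
      show "f {i} \<noteq> f {j}" "f {} \<noteq> f {i, j}" using ij by (intro inj; auto)+
    qed (use Bg ij in blast)+
    moreover have "g i <# A \<subseteq> carrier G" "g j <# A \<subseteq> carrier G"
      using l_coset_subset_G[OF A] Bg ij by blast+
    ultimately show ?thesis
      using Bg[OF ij(1)] Bg[OF ij(2)] crossing_compl_left crossing_commute by (metis Diff_subset)
  qed
  then show ?thesis using Bg by blast
qed

end

context marked_group
begin

text \<open>
  As \<open>A\<close> is invariant under \<open>H\<close>, the translate \<open>g <# A\<close> is determined by the coset \<open>g <# H\<close>.
  Therefore distinct translates belong to distinct cosets, and counting cosets suffices.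
\<close>

lemma l_coset_determines_translate:
  assumes H: "subgroup H G" and A: "A \<subseteq> carrier G" "H <#> A = A"
    and g: "g \<in> carrier G" "g' \<in> carrier G" "g <# H = g' <# H"
  shows "g <# A \<subseteq> g' <# A"
proof
  fix x assume "x \<in> g <# A"
  then obtain a where a: "a \<in> A" "x = g \<otimes> a" by (auto simp: l_coset_def)
  have "g \<otimes> \<one> \<in> g <# H" using subgroup.one_closed[OF H] unfolding l_coset_def by blast
  then have "g \<in> g' <# H" using g by simp
  then obtain h where h: "h \<in> H" "g = g' \<otimes> h" by (auto simp: l_coset_def)
  have "h \<otimes> a \<in> A" using A(2) h(1) a(1) by (auto simp: set_mult_def)
  moreover have "x = g' \<otimes> (h \<otimes> a)"
    using a h g A(1) subgroup.mem_carrier[OF H h(1)] by (auto simp: m_assoc)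
  ultimately show "x \<in> g' <# A" by (auto simp: l_coset_def)
qed

text \<open>
  The coboundary of each translate is near its coset, so crossing translates have close cosets, and
  bounded packing applies.
\<close>

theorem crossing_translates_bounded:
  assumes H: "subgroup H G" and M: "morse_set \<mu> H" and A: "almost_invariant G H A"
  shows "\<exists>N::nat. \<forall>n g. (\<forall>i<n. g i \<in> carrier G \<and>
      (\<forall>j<n. i \<noteq> j \<longrightarrow> crossing (carrier G) (g i <# A) (g j <# A))) \<longrightarrow> n \<le> N"
proof -
  have HG: "H \<subseteq> carrier G" and AG: "A \<subseteq> carrier G" and HA: "H <#> A = A"
    using subgroup.subset[OF H] A by (auto simp: almost_invariant_def)
  obtain r0 where r0: "coboundary_within r0 H A" using almost_invariant_coboundary[OF H A] by blast
  define r where "r = max r0 (\<mu> 1 0)"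
  have r: "coboundary_within r H A" "\<mu> 1 0 \<le> r"
    using r0 unfolding coboundary_within_def r_def by (auto simp: le_max_iff_disj)
  let ?N = "card {v \<in> carrier G. wdist \<one> v \<le> helly_radius \<mu> (2 * r)}"
  have "n \<le> ?N" if g: "\<forall>i<n. g i \<in> carrier G \<and>
      (\<forall>j<n. i \<noteq> j \<longrightarrow> crossing (carrier G) (g i <# A) (g j <# A))" for n g
  proof -
    have gG: "g i \<in> carrier G" if "i < n" for i using g that by blast
    have cross: "crossing (carrier G) (g i <# A) (g j <# A)" if "i < n" "j < n" "i \<noteq> j" for i j
      using g that by blast
    have ne: "g i <# H \<noteq> g j <# H" if "i < n" "j < n" "i \<noteq> j" for i j
    proof
      assume "g i <# H = g j <# H"
      then have "g i <# A \<subseteq> g j <# A"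
        using l_coset_determines_translate[OF H AG HA] gG that by blast
      then show False using cross[OF that] by (auto simp: crossing_def)
    qed
    then have "inj_on g {..<n}" by (metis inj_onI lessThan_iff)
    then have "n = card (g ` {..<n})" by (simp add: card_image)
    also have "\<dots> \<le> ?N"
    proof (rule bounded_packing[OF H M])
      show "inj_on (\<lambda>g. g <# H) (g ` {..<n})" using ne by (auto simp: inj_on_def)
      show "\<exists>y\<in>x <# H. dist_to (x' <# H) y \<le> 2 * r" if xx: "x \<in> g ` {..<n}" "x' \<in> g ` {..<n}" for x x'
      proof (cases "x = x'")
        case True
        have xG: "x \<in> carrier G" using gG xx by blast
        have "x \<in> x <# H" using subgroup.one_closed[OF H] xG unfolding l_coset_def by force
        then have "dist_to (x' <# H) x = 0" unfolding True[symmetric] using xG by (rule dist_to_eq_0)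
        then show ?thesis using \<open>x \<in> x <# H\<close> by (intro bexI[of _ x]) simp_all
      next
        case False
        obtain i j where ij0: "i < n" "j < n" "x = g i" "x' = g j" using xx by auto
        then have "i \<noteq> j" using False by blast
        note ij = ij0(1,2) \<open>i \<noteq> j\<close> ij0(3,4)
        have xG: "x \<in> carrier G" "x' \<in> carrier G" using gG ij by auto
        show ?thesis
          using crossing_sets_close[OF morse_set_translate[OF M xG(1)] morse_set_translate[OF M xG(2)] r(2)
              coboundary_within_translate[OF r(1) xG(1) HG AG]
              coboundary_within_translate[OF r(1) xG(2) HG AG]]
            cross[OF ij(1-3)] l_coset_subset_G[OF AG] xG
          unfolding crossing_def ij(4,5) by blast
      qed
    qed (use gG in auto)
    finally show ?thesis .
  qed
  then show ?thesis by blast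
qed

end


section \<open>Finite dimensionality\<close>

lemma strongly_quasiconvex_imp_morse_set:
  assumes "group G" "strongly_quasiconvex G H"
  shows "\<exists>S \<mu>. marked_group G S \<and>
    geodesic_graph_metric.morse_set (carrier G) (graph_dist (cayley_graph G S)) \<mu> H"
proof -
  obtain S where H: "subgroup H G" and S: "finite_generating_set G S"
      "strongly_quasiconvex_subset (realization (cayley_graph G S))
        (realization_dist (cayley_graph G S)) ((\<lambda>h. indicator {h}) ` H)"
    using assms(2) unfolding strongly_quasiconvex_def by blast
  interpret marked_group G S
    by (intro marked_group.intro marked_group_axioms.intro assms(1) S(1))
  have verts: "verts (cayley_graph G S) = carrier G" by (simp add: cayley_graph_def)
  have edges: "\<exists>a b. a \<noteq> b \<and> e = {a, b}" if "e \<in> edges (cayley_graph G S)" for e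
  proof -
    obtain g s where gs: "g \<in> carrier G" "s \<in> S" "s \<noteq> \<one>\<^bsub>G\<^esub>" "e = {g, g \<otimes>\<^bsub>G\<^esub> s}"
      using \<open>e \<in> edges (cayley_graph G S)\<close> unfolding cayley_graph_def by auto
    have "s \<in> carrier G" using S_carrier gs(2) by blast
    then have "g \<noteq> g \<otimes>\<^bsub>G\<^esub> s" using gs(1,3) by simp
    then show ?thesis using gs(4) by blast
  qed
  have "\<exists>\<mu>. morse_set \<mu> H"
    using strongly_quasiconvex_subset_imp_morse_set[of "cayley_graph G S" H, unfolded verts]
      edges geodesic_graph_metric_axioms subgroup.subset[OF H] subgroup.one_closed[OF H] S(2)
    by blast
  then show ?thesis using marked_group_axioms by blast
qed

theorem corollary1p3:
  fixes G :: "('a, 'm) monoid_scheme" and H A :: "'a set"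
  assumes "finitely_generated_group G"
    and "strongly_quasiconvex G H"
    and "codimension_one G H"
    and "almost_invariant G H A"
  shows "finite_dimensional (sageev_complex G A)"
proof -
  have G: "group G" and H: "subgroup H G" and A: "A \<subseteq> carrier G"
    using assms
    by (auto simp: finitely_generated_group_def strongly_quasiconvex_def almost_invariant_def)
  obtain S \<mu> where S: "marked_group G S"
      "geodesic_graph_metric.morse_set (carrier G) (graph_dist (cayley_graph G S)) \<mu> H"
    using strongly_quasiconvex_imp_morse_set[OF G assms(2)] by blast
  obtain N :: nat where N: "\<And>n g. \<forall>i<n. g i \<in> carrier G \<and>
      (\<forall>j<n. i \<noteq> j \<longrightarrow> crossing (carrier G) (g i <#\<^bsub>G\<^esub> A) (g j <#\<^bsub>G\<^esub> A)) \<Longrightarrow> n \<le> N"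
    using marked_group.crossing_translates_bounded[OF S(1) H S(2) assms(4)] by blast
  let ?X = "graph_component (sageev_graph G A) (principal_ultrafilter G A \<one>\<^bsub>G\<^esub>)"
  have "edges ?X \<subseteq> edges (sageev_graph G A)" by (auto simp: graph_component_def Let_def)
  then have "n \<le> N" if "(n, Q) \<in> sageev_complex G A" for n Q
    using that sageev_cube_crossing[OF G A, of Q ?X n] N
    unfolding sageev_complex_def attach_cubes_def by blast
  then show ?thesis unfolding finite_dimensional_def by blast
qed

end
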